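(* Let $K$ be a field, let $E$ be a row-finite directed graph, and let $J\subseteq L_K(E)$ be a graded ideal. Then (1) $J^\perp=I\bigl(E^0\setminus\overline{H}(J)\bigr)$; (2) $J^{\perp\perp}=I\bigl(\{w\in E^0: T(w)\subseteq\overline{H}(J)\}\bigr)$; (3) $J$ is regular if and only if $H(J)=\{w\in E^0: T(w)\subseteq\overline{H}(J)\}$.
   Context: A graph $E=(E^0,E^1,r,s)$ consists of a countable set of vertices $E^0$, a countable set of edges $E^1$, and range and source maps $r,s:E^1\to E^0$. It is row-finite if $s^{-1}(v)$ is finite for each vertex $v$. A nontrivial path is $\alpha=e_1\cdots e_n$ with $r(e_i)=s(e_{i+1})$ for $1\le i\le n-1$; its length is $|\alpha|=n$, $s(\alpha)=s(e_1)$, $r(\alpha)=r(e_n)$. Vertices are paths of length $0$ (with $s(v)=r(v)=v$). $E^*$ is the set of all finite paths. $E^0_{reg}$ is the set of vertices $v$ with $s^{-1}(v)$ nonempty and finite. The Leavitt path algebra $L_K(E)$ is the universal $K$-algebra generated by pairwise orthogonal idempotents $\{v:v\in E^0\}$ and elements $\{e,e^*:e\in E^1\}$ subject to: (1) $s(e)e=er(e)=e$ for all $e\in E^1$; (2) $r(e)e^*=e^*s(e)=e^*$ for all $e\in E^1$; (3) $e^*f=\delta_{e,f}\,r(e)$ for all $e,f\in E^1$; (4) $v=\sum_{e\in E^1,\,s(e)=v}ee^*$ for all $v\in E^0_{reg}$. For a path $\alpha=e_1\cdots e_n$, $\alpha^*=e_n^*\cdots e_1^*$, and $v^*=v$ for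 vertices. It is $\mathbb{Z}$-graded with homogeneous components $L_K(E)_n=\operatorname{span}_K\{\alpha\beta^*:\alpha,\beta\in E^*,\ |\alpha|-|\beta|=n\}$, and an ideal $J$ is graded if $J=\bigoplus_{n\in\mathbb{Z}}(J\cap L_K(E)_n)$. For a subset $X$ of an algebra $A$, $X^\perp=\{a\in A: ax=xa=0\text{ for all }x\in X\}$. A (two-sided) ideal $J\subseteq A$ is called regular if $J=J^{\perp\perp}$. A set $H\subseteq E^0$ is hereditary if $\alpha\in E^*$ and $s(\alpha)\in H$ imply $r(\alpha)\in H$. For hereditary $H$, $I(H)$ denotes the ideal of $L_K(E)$ generated by $H$, that is, $I(H)=\operatorname{span}\{\gamma\lambda^*:\gamma,\lambda\in E^*,\ r(\gamma)=r(\lambda)\in H\}$. For an ideal $J$ of $L_K(E)$: $H(J)=\{v\in E^0: v\in J\}$ and $\overline{H}(J)=\{s(\alpha):\alpha\in E^*,\ r(\alpha)\in H(J)\}$. For $v\in E^0$, the tree of $v$ is $T(v)=\{r(\alpha):\alpha\in E^*,\ s(\alpha)=v\}$. *)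

theory Defs
  imports
    "HOL-Library.Poly_Mapping"
    "HOL-Library.Countable_Set"
    "Graph_Theory.Arc_Walk"
begin

section \<open>Associative algebras, not necessarily unital\<close>

text \<open>
  If \<open>E\<^sup>0\<close> is infinite, \<open>L\<^sub>K(E)\<close> has no identity element, so the ring and module records of
  HOL-Algebra do not apply.  The field of scalars is a type of class \<^class>\<open>field\<close>.
\<close>

record ('k, 'a) nalg =
  Carrier :: "'a set"
  Zero :: 'a
  Add :: "'a \<Rightarrow> 'a \<Rightarrow> 'a"
  Mult :: "'a \<Rightarrow> 'a \<Rightarrow> 'a"
  Scale :: "'k \<Rightarrow> 'a \<Rightarrow> 'a"

locale nonunital_algebra =
  fixes A :: "('k::field, 'a) nalg"
  assumes zero_closed: "Zero A \<in> Carrier A"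
    and add_closed: "x \<in> Carrier A \<Longrightarrow> y \<in> Carrier A \<Longrightarrow> Add A x y \<in> Carrier A"
    and mult_closed: "x \<in> Carrier A \<Longrightarrow> y \<in> Carrier A \<Longrightarrow> Mult A x y \<in> Carrier A"
    and scale_closed: "x \<in> Carrier A \<Longrightarrow> Scale A c x \<in> Carrier A"
    and add_assoc: "x \<in> Carrier A \<Longrightarrow> y \<in> Carrier A \<Longrightarrow> z \<in> Carrier A \<Longrightarrow>
      Add A (Add A x y) z = Add A x (Add A y z)"
    and add_commute: "x \<in> Carrier A \<Longrightarrow> y \<in> Carrier A \<Longrightarrow> Add A x y = Add A y x"
    and add_zero: "x \<in> Carrier A \<Longrightarrow> Add A x (Zero A) = x"
    and add_inverse: "x \<in> Carrier A \<Longrightarrow> Add A x (Scale A (- 1) x) = Zero A"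
    and mult_assoc: "x \<in> Carrier A \<Longrightarrow> y \<in> Carrier A \<Longrightarrow> z \<in> Carrier A \<Longrightarrow>
      Mult A (Mult A x y) z = Mult A x (Mult A y z)"
    and distrib_left: "x \<in> Carrier A \<Longrightarrow> y \<in> Carrier A \<Longrightarrow> z \<in> Carrier A \<Longrightarrow>
      Mult A x (Add A y z) = Add A (Mult A x y) (Mult A x z)"
    and distrib_right: "x \<in> Carrier A \<Longrightarrow> y \<in> Carrier A \<Longrightarrow> z \<in> Carrier A \<Longrightarrow>
      Mult A (Add A x y) z = Add A (Mult A x z) (Mult A y z)"
    and scale_add: "x \<in> Carrier A \<Longrightarrow> y \<in> Carrier A \<Longrightarrow>
      Scale A c (Add A x y) = Add A (Scale A c x) (Scale A c y)"
    and add_scale: "x \<in> Carrier A \<Longrightarrow> Scale A (c + d) x = Add A (Scale A c x) (Scale A d x)"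
    and scale_scale: "x \<in> Carrier A \<Longrightarrow> Scale A c (Scale A d x) = Scale A (c * d) x"
    and scale_one: "x \<in> Carrier A \<Longrightarrow> Scale A 1 x = x"
    and scale_mult_left: "x \<in> Carrier A \<Longrightarrow> y \<in> Carrier A \<Longrightarrow>
      Mult A (Scale A c x) y = Scale A c (Mult A x y)"
    and scale_mult_right: "x \<in> Carrier A \<Longrightarrow> y \<in> Carrier A \<Longrightarrow>
      Mult A x (Scale A c y) = Scale A c (Mult A x y)"

definition subspace_of :: "('k, 'a) nalg \<Rightarrow> 'a set \<Rightarrow> bool" where
  "subspace_of A S \<longleftrightarrow> S \<subseteq> Carrier A \<and> Zero A \<in> S \<and>
     (\<forall>x\<in>S. \<forall>y\<in>S. Add A x y \<in> S) \<and> (\<forall>c. \<forall>x\<in>S. Scale A c x \<in> S)"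

definition span_of :: "('k, 'a) nalg \<Rightarrow> 'a set \<Rightarrow> 'a set" where
  "span_of A X = \<Inter>{S. subspace_of A S \<and> X \<subseteq> S}"

definition ideal_of :: "('k, 'a) nalg \<Rightarrow> 'a set \<Rightarrow> bool" where
  "ideal_of A J \<longleftrightarrow> subspace_of A J \<and>
     (\<forall>a\<in>Carrier A. \<forall>x\<in>J. Mult A a x \<in> J \<and> Mult A x a \<in> J)"

definition gen_ideal :: "('k, 'a) nalg \<Rightarrow> 'a set \<Rightarrow> 'a set" where
  "gen_ideal A X = \<Inter>{J. ideal_of A J \<and> X \<subseteq> J}"

definition perp :: "('k, 'a) nalg \<Rightarrow> 'a set \<Rightarrow> 'a set" where
  "perp A X = {a \<in> Carrier A. \<forall>x\<in>X. Mult A a x = Zero A \<and> Mult A x a = Zero A}"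

definition regular_ideal :: "('k, 'a) nalg \<Rightarrow> 'a set \<Rightarrow> bool" where
  "regular_ideal A J \<longleftrightarrow> ideal_of A J \<and> J = perp A (perp A J)"

text \<open>\<open>S\<close> is the internal direct sum of the family \<open>C\<close> of subspaces.\<close>

definition direct_sum_of :: "('k, 'a) nalg \<Rightarrow> 'a set \<Rightarrow> ('i \<Rightarrow> 'a set) \<Rightarrow> bool" where
  "direct_sum_of A S C \<longleftrightarrow> (\<forall>i. subspace_of A (C i)) \<and> S = span_of A (\<Union>i. C i) \<and>
     (\<forall>i. C i \<inter> span_of A (\<Union>j\<in>- {i}. C j) = {Zero A})"

definition coset_of :: "('k, 'a) nalg \<Rightarrow> 'a set \<Rightarrow> 'a \<Rightarrow> 'a set" where
  "coset_of A I a = {Add A a i | i. i \<in> I}"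

definition quotient_alg :: "('k, 'a) nalg \<Rightarrow> 'a set \<Rightarrow> ('k, 'a set) nalg" where
  "quotient_alg A I =
     \<lparr>Carrier = coset_of A I ` Carrier A,
      Zero = coset_of A I (Zero A),
      Add = (\<lambda>X Y. \<Union>x\<in>X. \<Union>y\<in>Y. coset_of A I (Add A x y)),
      Mult = (\<lambda>X Y. \<Union>x\<in>X. \<Union>y\<in>Y. coset_of A I (Mult A x y)),
      Scale = (\<lambda>c X. \<Union>x\<in>X. coset_of A I (Scale A c x))\<rparr>"

context nonunital_algebra
begin

lemma add_left_commute:
  assumes "x \<in> Carrier A" "y \<in> Carrier A" "z \<in> Carrier A"
  shows "Add A x (Add A y z) = Add A y (Add A x z)"
  using assms by (metis add_assoc add_commute)

lemma coset_eq:
  assumes I: "ideal_of A I" and a: "a \<in> Carrier A" and b: "b \<in> coset_of A I a"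
  shows "coset_of A I b = coset_of A I a"
proof -
  have sub: "subspace_of A I" and IC: "\<And>i. i \<in> I \<Longrightarrow> i \<in> Carrier A"
    using I unfolding ideal_of_def subspace_of_def by auto
  obtain i where i: "i \<in> I" and b': "b = Add A a i" using b unfolding coset_of_def by auto
  have "Add A b j = Add A a (Add A i j)" if "j \<in> I" for j
    unfolding b' using a i that IC by (simp add: add_assoc)
  moreover have "Add A a j = Add A b (Add A (Scale A (- 1) i) j)" if j: "j \<in> I" for j
  proof -
    have "Add A b (Add A (Scale A (- 1) i) j) = Add A a (Add A (Add A i (Scale A (- 1) i)) j)"
      unfolding b' using a i j IC by (simp add: add_assoc scale_closed add_closed)
    also have "\<dots> = Add A a (Add A (Zero A) j)"
      using i IC by (simp add: add_inverse)
    also have "\<dots> = Add A a j"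
      using j IC by (metis add_commute add_zero zero_closed)
    finally show ?thesis by simp
  qed
  moreover have "Add A i j \<in> I" "Add A (Scale A (- 1) i) j \<in> I" if "j \<in> I" for j
    using that i sub unfolding subspace_of_def by auto
  ultimately show ?thesis unfolding coset_of_def by blast
qed

lemma quotient_ops:
  assumes I: "ideal_of A I" and a: "a \<in> Carrier A" and b: "b \<in> Carrier A"
  shows "Add (quotient_alg A I) (coset_of A I a) (coset_of A I b) = coset_of A I (Add A a b)"
    and "Mult (quotient_alg A I) (coset_of A I a) (coset_of A I b) = coset_of A I (Mult A a b)"
    and "Scale (quotient_alg A I) c (coset_of A I a) = coset_of A I (Scale A c a)"
proof -
  have IC: "\<And>i. i \<in> I \<Longrightarrow> i \<in> Carrier A"
    and Ia: "\<And>i j. i \<in> I \<Longrightarrow> j \<in> I \<Longrightarrow> Add A i j \<in> I"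
    and Is: "\<And>i. i \<in> I \<Longrightarrow> Scale A c i \<in> I" and I0: "Zero A \<in> I"
    and Im: "\<And>a i. i \<in> I \<Longrightarrow> a \<in> Carrier A \<Longrightarrow> Mult A a i \<in> I \<and> Mult A i a \<in> I"
    using I unfolding ideal_of_def subspace_of_def by auto
  have self: "x \<in> coset_of A I x" if "x \<in> Carrier A" for x
    unfolding coset_of_def using I0 add_zero[OF that] by force
  have un: "(\<Union>x\<in>X. F x) = Z" if "x0 \<in> X" "\<And>x. x \<in> X \<Longrightarrow> F x = Z"
    for X Z x0 and F :: "'b \<Rightarrow> 'b set" using that by auto
  have "coset_of A I (Add A x y) = coset_of A I (Add A a b)"
    if "x \<in> coset_of A I a" "y \<in> coset_of A I b" for x y
  proof -
    obtain i j where *: "i \<in> I" "j \<in> I" "x = Add A a i" "y = Add A b j"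
      using \<open>x \<in> coset_of A I a\<close> \<open>y \<in> coset_of A I b\<close> unfolding coset_of_def by blast
    have "Add A x y = Add A (Add A a b) (Add A i j)"
      unfolding * using a b * IC by (simp add: add_assoc add_closed add_left_commute)
    then have "Add A x y \<in> coset_of A I (Add A a b)"
      unfolding coset_of_def using Ia * by blast
    then show ?thesis by (rule coset_eq[OF I add_closed[OF a b]])
  qed
  then show "Add (quotient_alg A I) (coset_of A I a) (coset_of A I b) = coset_of A I (Add A a b)"
    unfolding quotient_alg_def nalg.simps
    by (intro un[OF self[OF a]] un[OF self[OF b]])
  have "coset_of A I (Mult A x y) = coset_of A I (Mult A a b)"
    if "x \<in> coset_of A I a" "y \<in> coset_of A I b" for x y
  proof -
    obtain i j where *: "i \<in> I" "j \<in> I" "x = Add A a i" "y = Add A b j"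
      using \<open>x \<in> coset_of A I a\<close> \<open>y \<in> coset_of A I b\<close> unfolding coset_of_def by blast
    have "Mult A x y = Add A (Mult A a b) (Add A (Mult A a j) (Mult A i y))"
      unfolding * using a b * IC
      by (simp add: add_assoc add_left_commute add_closed mult_closed distrib_left distrib_right)
    moreover have "y \<in> Carrier A" using * b IC add_closed by auto
    ultimately have "Mult A x y \<in> coset_of A I (Mult A a b)"
      unfolding coset_of_def using Ia Im * a by blast
    then show ?thesis by (rule coset_eq[OF I mult_closed[OF a b]])
  qed
  then show "Mult (quotient_alg A I) (coset_of A I a) (coset_of A I b) = coset_of A I (Mult A a b)"
    unfolding quotient_alg_def nalg.simps
    by (intro un[OF self[OF a]] un[OF self[OF b]])
  have "coset_of A I (Scale A c x) = coset_of A I (Scale A c a)"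
    if "x \<in> coset_of A I a" for x
  proof -
    obtain i where *: "i \<in> I" "x = Add A a i"
      using \<open>x \<in> coset_of A I a\<close> unfolding coset_of_def by blast
    have "Scale A c x = Add A (Scale A c a) (Scale A c i)"
      unfolding * using a * IC by (simp add: scale_add)
    then have "Scale A c x \<in> coset_of A I (Scale A c a)"
      unfolding coset_of_def using Is * by blast
    then show ?thesis by (rule coset_eq[OF I scale_closed[OF a]])
  qed
  then show "Scale (quotient_alg A I) c (coset_of A I a) = coset_of A I (Scale A c a)"
    unfolding quotient_alg_def nalg.simps by (intro un[OF self[OF a]])
qed

lemma quotient_nonunital_algebra:
  assumes I: "ideal_of A I"
  shows "nonunital_algebra (quotient_alg A I)"
proof -
  have C: "Carrier (quotient_alg A I) = coset_of A I ` Carrier A"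
    and Z: "Zero (quotient_alg A I) = coset_of A I (Zero A)"
    by (simp_all add: quotient_alg_def)
  note ops = quotient_ops[OF I] zero_closed add_closed mult_closed scale_closed
  have comm: "Add (quotient_alg A I) X Y = Add (quotient_alg A I) Y X"
    if "X \<in> Carrier (quotient_alg A I)" "Y \<in> Carrier (quotient_alg A I)" for X Y
    using that unfolding C by (auto simp: ops add_commute)
  show ?thesis
  proof (standard, goal_cases)
    case (6 X Y)
    then show ?case by (rule comm)
  qed (unfold C Z, auto simp: ops add_zero add_inverse add_assoc mult_assoc distrib_left
      distrib_right scale_add add_scale scale_scale scale_one scale_mult_left scale_mult_right)
qed

lemma ideal_of_gen_ideal:
  assumes "X \<subseteq> Carrier A"
  shows "ideal_of A (gen_ideal A X)"
proof -
  have C: "ideal_of A (Carrier A)"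
    by (simp add: ideal_of_def subspace_of_def zero_closed add_closed scale_closed mult_closed)
  have sub: "gen_ideal A X \<subseteq> Carrier A"
    unfolding gen_ideal_def using C assms by (intro Inter_lower) simp
  have J: "subspace_of A J \<and> (\<forall>a\<in>Carrier A. \<forall>x\<in>J. Mult A a x \<in> J \<and> Mult A x a \<in> J)"
    if "J \<in> {J. ideal_of A J \<and> X \<subseteq> J}" for J
    using that by (simp add: ideal_of_def)
  show ?thesis
    using sub J unfolding ideal_of_def[of A "gen_ideal A X"] subspace_of_def
    by (simp add: gen_ideal_def)
qed

end


section \<open>Free algebras\<close>

text \<open>
  Words under concatenation.  With this instance, \<^typ>\<open>'x list \<Rightarrow>\<^sub>0 'k\<close> carries the convolution
  product and is the free unital algebra (noncommutative polynomials) over the letters \<^typ>\<open>'x\<close>.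
\<close>

instantiation list :: (type) monoid_add
begin

definition zero_list :: "'a list" where "zero_list = []"
definition plus_list :: "'a list \<Rightarrow> 'a list \<Rightarrow> 'a list" where "plus_list = (@)"

instance by standard (simp_all add: zero_list_def plus_list_def)

end

text \<open>
  The free algebra in the category of nonunital algebras: the linear combinations of nonempty
  words in the letters \<open>X\<close>.  Multiplication by \<open>single [] c\<close> is multiplication by the scalar \<open>c\<close>.
\<close>

definition free_alg :: "'x set \<Rightarrow> ('k::field, 'x list \<Rightarrow>\<^sub>0 'k) nalg" where
  "free_alg X =
     \<lparr>Carrier = {p. \<forall>w \<in> Poly_Mapping.keys p. w \<noteq> [] \<and> set w \<subseteq> X},
      Zero = 0,
      Add = (+),
      Mult = (*),
      Scale = (\<lambda>c p. Poly_Mapping.single [] c * p)\<rparr>"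

abbreviation word_elem :: "'x list \<Rightarrow> 'x list \<Rightarrow>\<^sub>0 'k::field" where
  "word_elem w \<equiv> Poly_Mapping.single w 1"

lemma single_Nil_commute:
  fixes p :: "'x list \<Rightarrow>\<^sub>0 'k::field"
  shows "Poly_Mapping.single [] c * p = p * Poly_Mapping.single [] c"
proof (induction p rule: update_induct)
  case const
  then show ?case by simp
next
  case (update f a b)
  have "Poly_Mapping.update a b f = Poly_Mapping.single a b + f"
    using update(1)
    by (intro poly_mapping_eqI)
      (auto simp: lookup_add lookup_update lookup_single in_keys_iff when_def)
  moreover have "Poly_Mapping.single [] c * Poly_Mapping.single a b =
      Poly_Mapping.single a b * Poly_Mapping.single [] c"
    by (simp add: mult_single plus_list_def mult.commute)
  ultimately show ?case
    using update(3) by (simp only: distrib_left distrib_right)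
qed

lemma free_alg_nonunital_algebra:
  fixes X :: "'x set"
  shows "nonunital_algebra (free_alg X :: ('k::field, _) nalg)"
proof -
  have 1: "Poly_Mapping.single [] (1::'k) = (1 :: 'x list \<Rightarrow>\<^sub>0 'k)"
    by (simp flip: zero_list_def)
  have m: "\<exists>u v. w = u @ v \<and> u \<in> Poly_Mapping.keys p \<and> v \<in> Poly_Mapping.keys q"
    if "w \<in> Poly_Mapping.keys (p * q)" for w and p q :: "'x list \<Rightarrow>\<^sub>0 'k"
    using keys_mult[of p q] that unfolding plus_list_def by blast
  show ?thesis
  proof (standard, goal_cases)
    case (2 x y)
    then show ?case using keys_add[of x y] by (auto simp: free_alg_def)
  next
    case (3 x y)
    then show ?case using m[of _ x y] by (fastforce simp: free_alg_def)
  next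
    case (4 x c)
    then show ?case
      using m[of _ "Poly_Mapping.single [] c" x] by (fastforce simp: free_alg_def split: if_splits)
  next
    case 6
    show ?case by (simp add: free_alg_def add.commute)
  next
    case (8 x)
    have "Poly_Mapping.single [] (- 1 :: 'k) = (- 1 :: 'x list \<Rightarrow>\<^sub>0 'k)"
      by (simp add: single_uminus 1)
    then show ?case by (simp add: free_alg_def)
  next
    case (14 x c d)
    then show ?case by (simp add: free_alg_def mult_single plus_list_def flip: mult.assoc)
  next
    case 15
    show ?case by (simp add: free_alg_def 1)
  next
    case (17 x y c)
    have "x * (Poly_Mapping.single [] c * y) = Poly_Mapping.single [] c * (x * y)"
      by (simp only: mult.assoc[symmetric] single_Nil_commute[of c x])
    then show ?case by (simp add: free_alg_def)
  next
    case 12 show ?case by (simp add: free_alg_def distrib_left)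
  next
    case 16 show ?case by (simp add: free_alg_def mult.assoc)
  qed (simp_all add: free_alg_def add.assoc mult.assoc distrib_left distrib_right single_add)
qed


section \<open>Leavitt path algebras\<close>

text \<open>
  A graph is a \<^typ>\<open>('v, 'e) pre_digraph\<close>: \<open>E\<^sup>0\<close> is \<^term>\<open>verts E\<close>, \<open>E\<^sup>1\<close> is \<^term>\<open>arcs E\<close>, the source
  map is \<^term>\<open>tail E\<close> and the range map is \<^term>\<open>head E\<close>; thus \<open>s\<inverse>(v)\<close> is \<^term>\<open>out_arcs E v\<close>.
\<close>

definition row_finite :: "('v, 'e) pre_digraph \<Rightarrow> bool" where
  "row_finite E \<longleftrightarrow> (\<forall>v \<in> verts E. finite (out_arcs E v))"

definition regular_verts :: "('v, 'e) pre_digraph \<Rightarrow> 'v set" where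
  "regular_verts E = {v \<in> verts E. out_arcs E v \<noteq> {} \<and> finite (out_arcs E v)}"

datatype ('v, 'e) lpa_gen = Vertex 'v | Edge 'e | Ghost 'e

definition lpa_gens :: "('v, 'e) pre_digraph \<Rightarrow> ('v, 'e) lpa_gen set" where
  "lpa_gens E = Vertex ` verts E \<union> Edge ` arcs E \<union> Ghost ` arcs E"

text \<open>Each defining relation \<open>a = b\<close> is represented by the element \<open>a - b\<close> of the free algebra.\<close>

definition lpa_relators ::
    "('v, 'e) pre_digraph \<Rightarrow> (('v, 'e) lpa_gen list \<Rightarrow>\<^sub>0 'k::field) set" where
  "lpa_relators E =
     {word_elem [Vertex v, Vertex w] - (if v = w then word_elem [Vertex v] else 0)
        | v w. v \<in> verts E \<and> w \<in> verts E} \<union>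
     {word_elem [Vertex (tail E e), Edge e] - word_elem [Edge e] | e. e \<in> arcs E} \<union>
     {word_elem [Edge e, Vertex (head E e)] - word_elem [Edge e] | e. e \<in> arcs E} \<union>
     {word_elem [Vertex (head E e), Ghost e] - word_elem [Ghost e] | e. e \<in> arcs E} \<union>
     {word_elem [Ghost e, Vertex (tail E e)] - word_elem [Ghost e] | e. e \<in> arcs E} \<union>
     {word_elem [Ghost e, Edge f] - (if e = f then word_elem [Vertex (head E e)] else 0)
        | e f. e \<in> arcs E \<and> f \<in> arcs E} \<union>
     {word_elem [Vertex v] - (\<Sum>e \<in> out_arcs E v. word_elem [Edge e, Ghost e])
        | v. v \<in> regular_verts E}"

definition lpa_ideal ::
    "('v, 'e) pre_digraph \<Rightarrow> (('v, 'e) lpa_gen list \<Rightarrow>\<^sub>0 'k::field) set" where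
  "lpa_ideal E = gen_ideal (free_alg (lpa_gens E)) (lpa_relators E)"

type_synonym ('v, 'e, 'k) lpa_elem = "(('v, 'e) lpa_gen list \<Rightarrow>\<^sub>0 'k) set"

definition lpa :: "('v, 'e) pre_digraph \<Rightarrow> ('k::field, ('v, 'e, 'k) lpa_elem) nalg" where
  "lpa E = quotient_alg (free_alg (lpa_gens E)) (lpa_ideal E)"

lemma lpa_relators_closed:
  fixes E :: "('v, 'e) pre_digraph"
  assumes "wf_digraph E"
  shows "(lpa_relators E :: (('v, 'e) lpa_gen list \<Rightarrow>\<^sub>0 'k::field) set)
    \<subseteq> Carrier (free_alg (lpa_gens E))"
proof -
  have sub: "p - q \<in> Carrier (free_alg X)"
    if "p \<in> Carrier (free_alg X)" "q \<in> Carrier (free_alg X)"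
    for p q :: "('v, 'e) lpa_gen list \<Rightarrow>\<^sub>0 'k" and X
    using that keys_diff[of p q] unfolding free_alg_def by auto
  have sum: "sum f S \<in> Carrier (free_alg X)" if "\<And>s. s \<in> S \<Longrightarrow> f s \<in> Carrier (free_alg X)"
    for f :: "'e \<Rightarrow> ('v, 'e) lpa_gen list \<Rightarrow>\<^sub>0 'k" and S X
  proof (cases "finite S")
    case True
    then show ?thesis
      using that
    proof (induction S rule: finite_induct)
      case (insert s S)
      have "f s \<in> Carrier (free_alg X)" "sum f S \<in> Carrier (free_alg X)"
        using insert by blast+
      then show ?case
        using keys_add[of "f s" "sum f S"] insert.hyps unfolding free_alg_def by auto
    qed (simp add: free_alg_def)
  qed (simp add: free_alg_def)
  have word: "word_elem w \<in> Carrier (free_alg X :: ('k, _) nalg)" if "w \<noteq> []" "set w \<subseteq> X"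
    for w :: "('v, 'e) lpa_gen list" and X
    using that by (simp add: free_alg_def)
  have zero: "0 \<in> Carrier (free_alg X :: ('k, _) nalg)" for X :: "('v, 'e) lpa_gen set"
    by (simp add: free_alg_def)
  have vert: "Vertex v \<in> lpa_gens E" if "v \<in> verts E" for v
    using that by (simp add: lpa_gens_def)
  have arc: "Edge e \<in> lpa_gens E" "Ghost e \<in> lpa_gens E"
    "Vertex (tail E e) \<in> lpa_gens E" "Vertex (head E e) \<in> lpa_gens E" if "e \<in> arcs E" for e
    using that assms by (auto simp: lpa_gens_def wf_digraph_def)
  have out: "(\<Sum>e \<in> out_arcs E v. word_elem [Edge e, Ghost e])
      \<in> Carrier (free_alg (lpa_gens E) :: ('k, _) nalg)" for v
    by (rule sum, rule word) (simp_all add: arc)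
  have "r \<in> Carrier (free_alg (lpa_gens E))" if "r \<in> lpa_relators E"
    for r :: "('v, 'e) lpa_gen list \<Rightarrow>\<^sub>0 'k"
    using that unfolding lpa_relators_def Un_iff mem_Collect_eq
    by (elim disjE exE conjE)
      (simp_all only:, auto intro!: sub word zero out simp: vert arc regular_verts_def)
  then show ?thesis by blast
qed

theorem lpa_nonunital_algebra:
  assumes "wf_digraph E"
  shows "nonunital_algebra (lpa E :: ('k::field, _) nalg)"
proof -
  interpret nonunital_algebra "free_alg (lpa_gens E) :: ('k, _) nalg"
    by (rule free_alg_nonunital_algebra)
  show ?thesis
    unfolding lpa_def lpa_ideal_def
    by (intro quotient_nonunital_algebra ideal_of_gen_ideal lpa_relators_closed assms)
qed

definition lpa_word ::
    "('v, 'e) pre_digraph \<Rightarrow> ('v, 'e) lpa_gen list \<Rightarrow> ('v, 'e, 'k::field) lpa_elem" where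
  "lpa_word E w = coset_of (free_alg (lpa_gens E)) (lpa_ideal E) (word_elem w)"

abbreviation lpa_vertex :: "('v, 'e) pre_digraph \<Rightarrow> 'v \<Rightarrow> ('v, 'e, 'k::field) lpa_elem" where
  "lpa_vertex E v \<equiv> lpa_word E [Vertex v]"

text \<open>
  A path \<open>\<alpha>\<close> is given by its source \<open>u\<close> and its list \<open>p\<close> of edges, subject to
  \<^term>\<open>pre_digraph.awalk E u p v\<close> where \<open>v = r(\<alpha>)\<close>.  The source is needed because the paths of
  length 0 are the vertices.
\<close>

definition lpa_path ::
    "('v, 'e) pre_digraph \<Rightarrow> 'v \<Rightarrow> 'e list \<Rightarrow> ('v, 'e, 'k::field) lpa_elem" where
  "lpa_path E u p = (if p = [] then lpa_vertex E u else lpa_word E (map Edge p))"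

definition lpa_path_star ::
    "('v, 'e) pre_digraph \<Rightarrow> 'v \<Rightarrow> 'e list \<Rightarrow> ('v, 'e, 'k::field) lpa_elem" where
  "lpa_path_star E u p = (if p = [] then lpa_vertex E u else lpa_word E (map Ghost (rev p)))"

definition lpa_comp :: "('v, 'e) pre_digraph \<Rightarrow> int \<Rightarrow> ('v, 'e, 'k::field) lpa_elem set" where
  "lpa_comp E n = span_of (lpa E)
     {Mult (lpa E) (lpa_path E u p) (lpa_path_star E u' q) | u p v u' q v'.
        pre_digraph.awalk E u p v \<and> pre_digraph.awalk E u' q v' \<and>
        int (length p) - int (length q) = n}"

definition graded_ideal :: "('v, 'e) pre_digraph \<Rightarrow> ('v, 'e, 'k::field) lpa_elem set \<Rightarrow> bool" where
  "graded_ideal E J \<longleftrightarrow> ideal_of (lpa E) J \<and> direct_sum_of (lpa E) J (\<lambda>n. J \<inter> lpa_comp E n)"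

definition lpa_I :: "('v, 'e) pre_digraph \<Rightarrow> 'v set \<Rightarrow> ('v, 'e, 'k::field) lpa_elem set" where
  "lpa_I E H = gen_ideal (lpa E) (lpa_vertex E ` H)"

definition lpa_H :: "('v, 'e) pre_digraph \<Rightarrow> ('v, 'e, 'k::field) lpa_elem set \<Rightarrow> 'v set" where
  "lpa_H E J = {v \<in> verts E. lpa_vertex E v \<in> J}"

definition lpa_Hbar :: "('v, 'e) pre_digraph \<Rightarrow> ('v, 'e, 'k::field) lpa_elem set \<Rightarrow> 'v set" where
  "lpa_Hbar E J = {u. \<exists>p v. pre_digraph.awalk E u p v \<and> v \<in> lpa_H E J}"

definition lpa_tree :: "('v, 'e) pre_digraph \<Rightarrow> 'v \<Rightarrow> 'v set" where
  "lpa_tree E v = {w. \<exists>p. pre_digraph.awalk E v p w}"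

end

theory Submission
  imports Defs
begin

text \<open>
  A graded ideal \<open>J\<close> of \<open>L\<^sub>K(E)\<close>, \<open>E\<close> row-finite, is generated by its vertices.  Right multiplication of
  a homogeneous element by edges shortens its ghost paths, and \<open>v = \<Sum> e e\<^sup>*\<close> recovers the element from
  these products, so one may assume \<open>x = \<Sum> c\<^sub>i \<gamma>\<^sub>i\<close> with distinct paths \<open>\<gamma>\<^sub>i\<close> of the same length;
  then \<open>\<gamma>\<^sub>i\<^sup>* x = c\<^sub>i r(\<gamma>\<^sub>i)\<close> puts \<open>r(\<gamma>\<^sub>i)\<close> into \<open>J\<close>.  The annihilator of \<open>J\<close> is again
  graded.  It contains a vertex \<open>v\<close> exactly if no path leads from \<open>v\<close> into \<open>H(J)\<close>:
  such a path with range \<open>h\<close> would give \<open>h = h h = 0\<close>; and if there is none, then every \<open>v w h\<close> with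
  \<open>h \<in> H(J)\<close> vanishes, because the trees of \<open>v\<close> and \<open>h\<close> are disjoint.  This gives (1); applying
  it to the annihilator gives (2), and (3) follows since a graded ideal is determined by its vertices.
\<close>

section \<open>Ideals of free algebras\<close>

lemma single_append:
  "Poly_Mapping.single (u :: 'x list) a * Poly_Mapping.single v b = Poly_Mapping.single (u @ v) (a * b)"
  by (simp add: mult_single plus_list_def)

lemma poly_mapping_sum_single:
  "p = (\<Sum>w\<in>Poly_Mapping.keys p. Poly_Mapping.single w (Poly_Mapping.lookup p w))"
  by (rule poly_mapping_eqI)
    (auto simp: lookup_sum lookup_single when_def in_keys_iff if_distrib cong: if_cong)

lemma poly_mapping_additive_induct [case_names single add]:
  fixes p :: "'a \<Rightarrow>\<^sub>0 'b::comm_monoid_add"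
  assumes single: "\<And>w c. P (Poly_Mapping.single w c)"
    and add: "\<And>p q. P p \<Longrightarrow> P q \<Longrightarrow> P (p + q)"
  shows "P p"
proof -
  have "P (\<Sum>w\<in>S. Poly_Mapping.single w (Poly_Mapping.lookup p w))" if "finite S" for S
    using that
  proof (induction S rule: finite_induct)
    case empty
    \<comment> \<open>The empty sum is 0, which is also the monomial with coefficient 0 at any key;
      \<open>undefined\<close> stands for that key.\<close>
    show ?case using single[of undefined 0] by simp
  qed (simp add: single add)
  from this[OF finite_keys[of p]] show ?thesis
    by (subst poly_mapping_sum_single)
qed

lemma free_alg_simps [simp]:
  "Zero (free_alg X) = 0" "Add (free_alg X) = (+)" "Mult (free_alg X) = (*)"
  "Scale (free_alg X) c p = Poly_Mapping.single [] c * p"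
  by (simp_all add: free_alg_def)

lemma carrier_free_alg:
  "p \<in> Carrier (free_alg X) \<longleftrightarrow> (\<forall>w \<in> Poly_Mapping.keys p. w \<noteq> [] \<and> set w \<subseteq> X)"
  by (simp add: free_alg_def)

lemma single_in_free_alg: "w \<noteq> [] \<Longrightarrow> set w \<subseteq> X \<Longrightarrow> Poly_Mapping.single w c \<in> Carrier (free_alg X)"
  by (simp add: carrier_free_alg)

locale free_alg_ideal =
  fixes X :: "'x set" and J :: "('x list \<Rightarrow>\<^sub>0 'k::field) set"
  assumes ideal: "ideal_of (free_alg X) J"
begin

lemma closed: "x \<in> J \<Longrightarrow> x \<in> Carrier (free_alg X)"
  and zero: "0 \<in> J"
  and add: "x \<in> J \<Longrightarrow> y \<in> J \<Longrightarrow> x + y \<in> J"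
  and scale: "x \<in> J \<Longrightarrow> Poly_Mapping.single [] c * x \<in> J"
  and mult_left: "x \<in> J \<Longrightarrow> a \<in> Carrier (free_alg X) \<Longrightarrow> a * x \<in> J"
  and mult_right: "x \<in> J \<Longrightarrow> a \<in> Carrier (free_alg X) \<Longrightarrow> x * a \<in> J"
  using ideal unfolding ideal_of_def subspace_of_def by auto

text \<open>The empty word lies outside the carrier, but multiplying by it is multiplying by a
  scalar; every other word over \<open>X\<close> is an element of the algebra itself.\<close>

lemma single_left: "x \<in> J \<Longrightarrow> set w \<subseteq> X \<Longrightarrow> Poly_Mapping.single w c * x \<in> J"
  by (cases "w = []") (auto intro: scale mult_left single_in_free_alg)

lemma single_right: "x \<in> J \<Longrightarrow> set w \<subseteq> X \<Longrightarrow> x * Poly_Mapping.single w c \<in> J"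
  using scale[of x c] by (cases "w = []") (auto simp: single_Nil_commute intro: mult_right single_in_free_alg)

lemma uminus: "x \<in> J \<Longrightarrow> - x \<in> J"
  using scale[of x "- 1"] by (simp add: single_uminus flip: zero_list_def)

lemma sum: "(\<And>i. i \<in> S \<Longrightarrow> f i \<in> J) \<Longrightarrow> sum f S \<in> J"
  by (induction S rule: infinite_finite_induct) (auto intro: zero add)

end

text \<open>Every element is a finite sum of monomials, so closure under monomials gives closure
  under all products. Allowing the empty word also covers the scalars.\<close>

lemma ideal_of_free_algI:
  fixes J :: "('x list \<Rightarrow>\<^sub>0 'k::field) set"
  assumes closed: "\<And>x. x \<in> J \<Longrightarrow> x \<in> Carrier (free_alg X)"
    and zero: "0 \<in> J"
    and add: "\<And>x y. x \<in> J \<Longrightarrow> y \<in> J \<Longrightarrow> x + y \<in> J"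
    and left: "\<And>x w c. x \<in> J \<Longrightarrow> set w \<subseteq> X \<Longrightarrow> Poly_Mapping.single w c * x \<in> J"
    and right: "\<And>x w c. x \<in> J \<Longrightarrow> set w \<subseteq> X \<Longrightarrow> x * Poly_Mapping.single w c \<in> J"
  shows "ideal_of (free_alg X) J"
proof -
  have sum: "sum f S \<in> J" if "\<And>i. i \<in> S \<Longrightarrow> f i \<in> J" for f S
    using that by (induction S rule: infinite_finite_induct) (auto intro: zero add)
  have "a * x \<in> J \<and> x * a \<in> J" if x: "x \<in> J" and a: "a \<in> Carrier (free_alg X)" for a x
  proof -
    define f S where "f w = Poly_Mapping.single w (Poly_Mapping.lookup a w)" and "S = Poly_Mapping.keys a" for w
    have "a = sum f S"
      unfolding f_def S_def by (rule poly_mapping_sum_single)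
    then have "a * x = (\<Sum>w\<in>S. f w * x)" "x * a = (\<Sum>w\<in>S. x * f w)"
      by (simp_all only: sum_distrib_left sum_distrib_right)
    moreover have "f w * x \<in> J" "x * f w \<in> J" if "w \<in> S" for w
      using a that unfolding f_def S_def carrier_free_alg by (auto intro: left right x)
    ultimately show ?thesis by (simp add: sum)
  qed
  moreover have "Poly_Mapping.single [] c * x \<in> J" if "x \<in> J" for x c
    using left[of x "[]"] that by simp
  ultimately show ?thesis
    by (simp add: ideal_of_def subspace_of_def zero add subsetI[OF closed])
qed


section \<open>The degree grading\<close>

text \<open>With these degrees all defining relators are homogeneous, so the grading of the free
  algebra passes to the quotient.\<close>

primrec letter_deg :: "('v, 'e) lpa_gen \<Rightarrow> int" where
  "letter_deg (Vertex v) = 0"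
| "letter_deg (Edge e) = 1"
| "letter_deg (Ghost e) = - 1"

definition word_deg :: "('v, 'e) lpa_gen list \<Rightarrow> int" where
  "word_deg w = sum_list (map letter_deg w)"

lemma word_deg_simps [simp]:
  "word_deg [] = 0" "word_deg (g # w) = letter_deg g + word_deg w"
  "word_deg (u @ w) = word_deg u + word_deg w"
  "word_deg (map Edge p) = int (length p)" "word_deg (map Ghost p) = - int (length p)"
  by (induction p) (simp_all add: word_deg_def)

definition deg_part :: "int \<Rightarrow> (('v, 'e) lpa_gen list \<Rightarrow>\<^sub>0 'k::field) \<Rightarrow> (('v, 'e) lpa_gen list \<Rightarrow>\<^sub>0 'k)" where
  "deg_part n p = (\<Sum>w | w \<in> Poly_Mapping.keys p \<and> word_deg w = n.
     Poly_Mapping.single w (Poly_Mapping.lookup p w))"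

lemma lookup_deg_part:
  "Poly_Mapping.lookup (deg_part n p) w = (if word_deg w = n then Poly_Mapping.lookup p w else 0)"
  by (auto simp: deg_part_def lookup_sum lookup_single when_def in_keys_iff if_distrib cong: if_cong)

lemma keys_deg_part: "Poly_Mapping.keys (deg_part n p) = {w \<in> Poly_Mapping.keys p. word_deg w = n}"
  by (auto simp: in_keys_iff lookup_deg_part split: if_splits)

lemma deg_part_in_free_alg: "p \<in> Carrier (free_alg X) \<Longrightarrow> deg_part n p \<in> Carrier (free_alg X)"
  by (simp add: carrier_free_alg keys_deg_part)

lemma deg_part_0 [simp]: "deg_part n 0 = 0"
  by (rule poly_mapping_eqI) (simp add: lookup_deg_part)

lemma deg_part_add [simp]: "deg_part n (p + q) = deg_part n p + deg_part n q"
  by (rule poly_mapping_eqI) (simp add: lookup_deg_part lookup_add)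

lemma deg_part_diff [simp]: "deg_part n (p - q) = deg_part n p - deg_part n q"
  by (rule poly_mapping_eqI) (simp add: lookup_deg_part lookup_minus)

lemma deg_part_sum: "deg_part n (sum f S) = (\<Sum>i\<in>S. deg_part n (f i))"
  by (induction S rule: infinite_finite_induct) simp_all

lemma deg_part_single:
  "deg_part n (Poly_Mapping.single w c) = (if word_deg w = n then Poly_Mapping.single w c else 0)"
  by (rule poly_mapping_eqI) (auto simp: lookup_deg_part lookup_single when_def)

lemma deg_part_deg_part: "deg_part m (deg_part n p) = (if m = n then deg_part n p else 0)"
  by (rule poly_mapping_eqI) (simp add: lookup_deg_part)

lemma sum_deg_part: "p = (\<Sum>n \<in> word_deg ` Poly_Mapping.keys p. deg_part n p)"
proof (rule poly_mapping_eqI)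
  fix w
  show "Poly_Mapping.lookup p w =
      Poly_Mapping.lookup (\<Sum>n \<in> word_deg ` Poly_Mapping.keys p. deg_part n p) w"
    by (cases "w \<in> Poly_Mapping.keys p") (auto simp: lookup_sum lookup_deg_part in_keys_iff)
qed

text \<open>For monomials this is additivity of \<open>word_deg\<close>, and bilinearity of the
  product does the rest.\<close>

lemma deg_part_mult_homogeneous:
  assumes "deg_part m y = y"
  shows "deg_part n (x * y) = deg_part (n - m) x * y" "deg_part n (y * x) = y * deg_part (n - m) x"
proof -
  have y: "word_deg w = m" if "w \<in> Poly_Mapping.keys y" for w
    using that assms keys_deg_part[of m y] by auto
  have eq: "y = (\<Sum>w\<in>Poly_Mapping.keys y. Poly_Mapping.single w (Poly_Mapping.lookup y w))"
    by (rule poly_mapping_sum_single)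
  have "deg_part n (x * Poly_Mapping.single w c) = deg_part (n - m) x * Poly_Mapping.single w c"
    "deg_part n (Poly_Mapping.single w c * x) = Poly_Mapping.single w c * deg_part (n - m) x"
    if "word_deg w = m" for w c
    using that by (induction x rule: poly_mapping_additive_induct)
      (auto simp: deg_part_single single_append distrib_left distrib_right)
  note single = this
  \<comment> \<open>Arbitrary \<open>S\<close> and \<open>f\<close> keep \<open>y\<close> out of
    this claim, so that the expansion of \<open>y\<close> is not applied inside its own
    support.\<close>
  have "deg_part n (x * (\<Sum>w\<in>S. Poly_Mapping.single w (f w))) =
      deg_part (n - m) x * (\<Sum>w\<in>S. Poly_Mapping.single w (f w))"
    "deg_part n ((\<Sum>w\<in>S. Poly_Mapping.single w (f w)) * x) =
      (\<Sum>w\<in>S. Poly_Mapping.single w (f w)) * deg_part (n - m) x"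
    if "\<And>w. w \<in> S \<Longrightarrow> word_deg w = m" for S f
    using that
    by (auto simp: sum_distrib_left sum_distrib_right deg_part_sum single intro!: sum.cong)
  from this[of "Poly_Mapping.keys y" "Poly_Mapping.lookup y", OF y]
  show "deg_part n (x * y) = deg_part (n - m) x * y" "deg_part n (y * x) = y * deg_part (n - m) x"
    by (simp_all only: eq[symmetric])
qed

lemma deg_part_single_mult:
  "deg_part n (x * Poly_Mapping.single w c) = deg_part (n - word_deg w) x * Poly_Mapping.single w c"
  "deg_part n (Poly_Mapping.single w c * x) = Poly_Mapping.single w c * deg_part (n - word_deg w) x"
  by (simp_all add: deg_part_mult_homogeneous deg_part_single)

section \<open>Reduction of words in a Leavitt path algebra\<close>

lemma (in wf_digraph) free_alg_ideal_lpa_ideal: "free_alg_ideal (lpa_gens G) (lpa_ideal G)"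
proof -
  interpret nonunital_algebra "free_alg (lpa_gens G) :: ('k::field, _) nalg"
    by (rule free_alg_nonunital_algebra)
  show "free_alg_ideal (lpa_gens G) (lpa_ideal G :: (_ \<Rightarrow>\<^sub>0 'k) set)"
    unfolding free_alg_ideal_def lpa_ideal_def
    by (rule ideal_of_gen_ideal) (rule lpa_relators_closed[OF wf_digraph_axioms])
qed

text \<open>The \<open>itself\<close> argument fixes the field of scalars, which the graph does not
  determine.\<close>

locale row_finite_lpa = wf_digraph E for E :: "('v, 'e) pre_digraph" +
  fixes scalars :: "'k::field itself"
  assumes row_finite: "row_finite E"
begin

sublocale lpa_ideal: free_alg_ideal "lpa_gens E" "lpa_ideal E :: (('v, 'e) lpa_gen list \<Rightarrow>\<^sub>0 'k) set"
  by (rule free_alg_ideal_lpa_ideal)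

lemma relator_in_lpa_ideal: "x \<in> lpa_relators E \<Longrightarrow> x \<in> lpa_ideal E"
  unfolding lpa_ideal_def gen_ideal_def by blast

section \<open>Congruence modulo the defining ideal\<close>

definition lpa_cong :: "(('v, 'e) lpa_gen list \<Rightarrow>\<^sub>0 'k) \<Rightarrow> (('v, 'e) lpa_gen list \<Rightarrow>\<^sub>0 'k) \<Rightarrow> bool"
    (infix "\<doteq>" 50) where
  "x \<doteq> y \<longleftrightarrow> x - y \<in> lpa_ideal E"

lemma cong_0_iff: "x \<doteq> 0 \<longleftrightarrow> x \<in> lpa_ideal E"
  by (simp add: lpa_cong_def)

lemma cong_refl [simp]: "x \<doteq> x"
  by (simp add: lpa_cong_def lpa_ideal.zero)

lemma cong_sym: "x \<doteq> y \<Longrightarrow> y \<doteq> x"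
  using lpa_ideal.uminus[of "x - y"] by (simp add: lpa_cong_def)

lemma cong_trans [trans]: "x \<doteq> y \<Longrightarrow> y \<doteq> z \<Longrightarrow> x \<doteq> z"
  using lpa_ideal.add[of "x - y" "y - z"] by (simp add: lpa_cong_def)

lemma cong_add: "x \<doteq> y \<Longrightarrow> x' \<doteq> y' \<Longrightarrow> x + x' \<doteq> y + y'"
  using lpa_ideal.add[of "x - y" "x' - y'"]
  by (simp add: lpa_cong_def add_diff_add)

lemma cong_sum: "(\<And>i. i \<in> S \<Longrightarrow> f i \<doteq> g i) \<Longrightarrow> sum f S \<doteq> sum g S"
  by (induction S rule: infinite_finite_induct) (auto intro: cong_add)

lemma cong_single_left:
  "x \<doteq> y \<Longrightarrow> set w \<subseteq> lpa_gens E \<Longrightarrow> Poly_Mapping.single w c * x \<doteq> Poly_Mapping.single w c * y"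
  using lpa_ideal.single_left[of "x - y"]
  by (simp add: lpa_cong_def right_diff_distrib)

lemma cong_single_right:
  "x \<doteq> y \<Longrightarrow> set w \<subseteq> lpa_gens E \<Longrightarrow> x * Poly_Mapping.single w c \<doteq> y * Poly_Mapping.single w c"
  using lpa_ideal.single_right[of "x - y"]
  by (simp add: lpa_cong_def left_diff_distrib)

lemma cong_word:
  assumes "word_elem w \<doteq> word_elem w'" "set u \<subseteq> lpa_gens E" "set v \<subseteq> lpa_gens E"
  shows "word_elem (u @ w @ v) \<doteq> word_elem (u @ w' @ v)"
  using cong_single_left[OF cong_single_right[OF assms(1,3), of 1] assms(2), of 1]
  by (simp add: single_append)

lemma cong_word_0:
  assumes "word_elem w \<doteq> 0" "set u \<subseteq> lpa_gens E" "set v \<subseteq> lpa_gens E"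
  shows "word_elem (u @ w @ v) \<doteq> 0"
  using cong_single_left[OF cong_single_right[OF assms(1,3), of 1] assms(2), of 1]
  by (simp add: single_append)

lemma lpa_gens_iff [simp]:
  "Vertex v \<in> lpa_gens E \<longleftrightarrow> v \<in> verts E" "Edge e \<in> lpa_gens E \<longleftrightarrow> e \<in> arcs E"
  "Ghost e \<in> lpa_gens E \<longleftrightarrow> e \<in> arcs E"
  by (auto simp: lpa_gens_def)

lemma cong_relators:
  "v \<in> verts E \<Longrightarrow> word_elem [Vertex v, Vertex v] \<doteq> word_elem [Vertex v]"
  "v \<in> verts E \<Longrightarrow> w \<in> verts E \<Longrightarrow> v \<noteq> w \<Longrightarrow> word_elem [Vertex v, Vertex w] \<doteq> 0"
  "e \<in> arcs E \<Longrightarrow> word_elem [Vertex (tail E e), Edge e] \<doteq> word_elem [Edge e]"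
  "e \<in> arcs E \<Longrightarrow> word_elem [Edge e, Vertex (head E e)] \<doteq> word_elem [Edge e]"
  "e \<in> arcs E \<Longrightarrow> word_elem [Vertex (head E e), Ghost e] \<doteq> word_elem [Ghost e]"
  "e \<in> arcs E \<Longrightarrow> word_elem [Ghost e, Vertex (tail E e)] \<doteq> word_elem [Ghost e]"
  "e \<in> arcs E \<Longrightarrow> word_elem [Ghost e, Edge e] \<doteq> word_elem [Vertex (head E e)]"
  "e \<in> arcs E \<Longrightarrow> f \<in> arcs E \<Longrightarrow> e \<noteq> f \<Longrightarrow> word_elem [Ghost e, Edge f] \<doteq> 0"
  "v \<in> regular_verts E \<Longrightarrow> word_elem [Vertex v] \<doteq> (\<Sum>e \<in> out_arcs E v. word_elem [Edge e, Ghost e])"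
  unfolding lpa_cong_def
  subgoal by (rule relator_in_lpa_ideal, unfold lpa_relators_def,
      rule UnI1, rule UnI1, rule UnI1, rule UnI1, rule UnI1, rule UnI1,
      rule CollectI, rule exI[of _ v], rule exI[of _ v], simp)
  subgoal by (rule relator_in_lpa_ideal, unfold lpa_relators_def,
      rule UnI1, rule UnI1, rule UnI1, rule UnI1, rule UnI1, rule UnI1,
      rule CollectI, rule exI[of _ v], rule exI[of _ w], simp)
  subgoal by (rule relator_in_lpa_ideal, unfold lpa_relators_def,
      rule UnI1, rule UnI1, rule UnI1, rule UnI1, rule UnI1, rule UnI2,
      rule CollectI, rule exI[of _ e], simp)
  subgoal by (rule relator_in_lpa_ideal, unfold lpa_relators_def,
      rule UnI1, rule UnI1, rule UnI1, rule UnI1, rule UnI2,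
      rule CollectI, rule exI[of _ e], simp)
  subgoal by (rule relator_in_lpa_ideal, unfold lpa_relators_def,
      rule UnI1, rule UnI1, rule UnI1, rule UnI2,
      rule CollectI, rule exI[of _ e], simp)
  subgoal by (rule relator_in_lpa_ideal, unfold lpa_relators_def,
      rule UnI1, rule UnI1, rule UnI2,
      rule CollectI, rule exI[of _ e], simp)
  subgoal by (rule relator_in_lpa_ideal, unfold lpa_relators_def,
      rule UnI1, rule UnI2,
      rule CollectI, rule exI[of _ e], rule exI[of _ e], simp)
  subgoal by (rule relator_in_lpa_ideal, unfold lpa_relators_def,
      rule UnI1, rule UnI2,
      rule CollectI, rule exI[of _ e], rule exI[of _ f], simp)
  subgoal by (rule relator_in_lpa_ideal, unfold lpa_relators_def,
      rule UnI2,
      rule CollectI, rule exI[of _ v], simp)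
  done

text \<open>The vertex that fixes a generator from the left; for a ghost edge source and range are
  exchanged.\<close>

primrec left_vertex :: "('v, 'e) lpa_gen \<Rightarrow> 'v" where
  "left_vertex (Vertex v) = v"
| "left_vertex (Edge e) = tail E e"
| "left_vertex (Ghost e) = head E e"

primrec right_vertex :: "('v, 'e) lpa_gen \<Rightarrow> 'v" where
  "right_vertex (Vertex v) = v"
| "right_vertex (Edge e) = head E e"
| "right_vertex (Ghost e) = tail E e"

lemma gen_vertices:
  assumes "g \<in> lpa_gens E"
  shows "left_vertex g \<in> verts E" "right_vertex g \<in> verts E"
    "word_elem [Vertex (left_vertex g), g] \<doteq> word_elem [g]"
    "word_elem [g, Vertex (right_vertex g)] \<doteq> word_elem [g]"
  using assms by (cases g; auto intro: cong_relators)+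

lemma word_left_vertex:
  assumes "set w \<subseteq> lpa_gens E" "w \<noteq> []"
  shows "word_elem (Vertex (left_vertex (hd w)) # w) \<doteq> word_elem w"
  using assms cong_word[OF gen_vertices(3)[of "hd w"], of "[]" "tl w"]
  by (cases w) auto

lemma word_right_vertex:
  assumes "set w \<subseteq> lpa_gens E" "w \<noteq> []"
  shows "word_elem (w @ [Vertex (right_vertex (last w))]) \<doteq> word_elem w"
  using assms cong_word[OF gen_vertices(4)[of "last w"], of "butlast w" "[]"]
  by (cases w rule: rev_cases) auto

text \<open>The two end vertices can be inserted between the words without changing the class, and
  distinct vertices are orthogonal.\<close>

lemma words_mismatch:
  assumes "set w \<subseteq> lpa_gens E" "w \<noteq> []" "set w' \<subseteq> lpa_gens E" "w' \<noteq> []"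
    and ne: "right_vertex (last w) \<noteq> left_vertex (hd w')"
  shows "word_elem (w @ w') \<doteq> 0"
proof -
  let ?v = "right_vertex (last w)" and ?u = "left_vertex (hd w')"
  have uv: "?v \<in> verts E" "?u \<in> verts E"
    using assms gen_vertices(2)[of "last w"] gen_vertices(1)[of "hd w'"]
    by (simp_all add: subsetD)
  have "word_elem (w @ w') \<doteq> word_elem ((w @ [Vertex ?v]) @ w')"
    using cong_word[OF cong_sym[OF word_right_vertex[OF assms(1,2)]], of "[]" w'] assms by simp
  also have "\<dots> \<doteq> word_elem ((w @ [Vertex ?v]) @ Vertex ?u # w')"
    using cong_word[OF cong_sym[OF word_left_vertex[OF assms(3,4)]], of "w @ [Vertex ?v]" "[]"] assms uv
    by simp
  also have "\<dots> \<doteq> 0"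
    using cong_word_0[OF cong_relators(2)[OF uv ne], of w w'] assms by simp
  finally show ?thesis .
qed

section \<open>Path monomials and the reduction of words to them\<close>

text \<open>\<open>path_mono p v q\<close> stands for \<open>p v q\<^sup>*\<close>, where \<open>v\<close> is the common range of \<open>p\<close> and \<open>q\<close>.\<close>

definition path_mono :: "'e list \<Rightarrow> 'v \<Rightarrow> 'e list \<Rightarrow> ('v, 'e) lpa_gen list" where
  "path_mono p v q = map Edge p @ Vertex v # map Ghost (rev q)"

text \<open>\<open>s\<close> and \<open>u\<close> are the vertices at the two ends, \<open>n\<close>
  is the degree. An upper bound \<open>m\<close> on the ghost length makes the sets increase with
  \<open>m\<close>; it is the parameter of the later induction.\<close>

definition path_monos :: "'v \<Rightarrow> 'v \<Rightarrow> nat \<Rightarrow> int \<Rightarrow> ('v, 'e) lpa_gen list set" where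
  "path_monos s u m n = {path_mono p v q | p v q.
     awalk s p v \<and> awalk u q v \<and> length q \<le> m \<and> int (length p) - int (length q) = n}"

lemma path_monosI:
  "awalk s p v \<Longrightarrow> awalk u q v \<Longrightarrow> length q \<le> m \<Longrightarrow> int (length p) - int (length q) = n \<Longrightarrow>
    path_mono p v q \<in> path_monos s u m n"
  unfolding path_monos_def by blast

lemma path_monos_mono: "m \<le> m' \<Longrightarrow> path_monos s u m n \<subseteq> path_monos s u m' n"
  unfolding path_monos_def by (blast intro: le_trans)

lemma path_mono_word:
  assumes "awalk s p v" "awalk u q v"
  shows "path_mono p v q \<noteq> []" "set (path_mono p v q) \<subseteq> lpa_gens E"
    "left_vertex (hd (path_mono p v q)) = s" "right_vertex (last (path_mono p v q)) = u"
proof -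
  have "set p \<subseteq> arcs E" "set q \<subseteq> arcs E" "v \<in> verts E"
    using assms awalk_last_in_verts by (auto simp: awalk_def)
  then show "set (path_mono p v q) \<subseteq> lpa_gens E"
    by (auto simp: path_mono_def)
  show "left_vertex (hd (path_mono p v q)) = s"
    using assms(1) by (cases p) (auto simp: path_mono_def awalk_simps)
  show "right_vertex (last (path_mono p v q)) = u"
    using assms(2) by (cases q) (auto simp: path_mono_def awalk_simps)
qed (simp add: path_mono_def)

lemma path_monos_word:
  assumes "w \<in> path_monos s u m n"
  shows "w \<noteq> []" "set w \<subseteq> lpa_gens E" "left_vertex (hd w) = s" "right_vertex (last w) = u"
proof -
  obtain p v q where "w = path_mono p v q" "awalk s p v" "awalk u q v"
    using assms unfolding path_monos_def by blast
  then show "w \<noteq> []" "set w \<subseteq> lpa_gens E" "left_vertex (hd w) = s" "right_vertex (last w) = u"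
    by (simp_all only: path_mono_word not_False_eq_True)
qed

text \<open>The last ghost letter belongs to the first edge of \<open>p\<close> and meets the first
  edge of \<open>p'\<close>, so pairs cancel from the middle until all are used up or two edges
  differ. The condition \<open>v = v'\<close> decides the case of length 0.\<close>

lemma ghost_path_mult_path:
  assumes "awalk s p v" "awalk s' p' v'" "length p = length p'"
  shows "word_elem (path_mono [] v p @ path_mono p' v' []) \<doteq>
    (if p = p' \<and> v = v' then word_elem [Vertex v] else 0)"
  using assms
proof (induction p arbitrary: s s' p')
  case Nil
  then show ?case
    by (auto simp: path_mono_def awalk_simps intro: cong_relators)
next
  case (Cons e p)
  then obtain f p'' where p': "p' = f # p''" by (cases p') auto
  have e: "e \<in> arcs E" "awalk (head E e) p v" and f: "f \<in> arcs E" "awalk (head E f) p'' v'"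
    using Cons.prems p' by (auto simp: awalk_simps)
  have v: "awalk v [] v" "awalk v' [] v'"
    using e f by (auto simp: awalk_Nil_iff dest: awalk_last_in_verts)
  note w1 = path_mono_word[OF v(1) e(2)] and w2 = path_mono_word[OF f(2) v(2)]
  have eq: "path_mono [] v (e # p) @ path_mono (f # p'') v' [] =
      path_mono [] v p @ [Ghost e, Edge f] @ path_mono p'' v' []"
    by (simp add: path_mono_def)
  show ?case
  proof (cases "e = f")
    case False
    then show ?thesis
      using cong_word_0[OF cong_relators(8)[OF e(1) f(1) False] w1(2) w2(2)] unfolding p' eq by simp
  next
    case True
    have "word_elem (path_mono [] v (e # p) @ path_mono (f # p'') v' []) \<doteq>
        word_elem (path_mono [] v p @ [Vertex (head E e)] @ path_mono p'' v' [])"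
      unfolding eq using cong_word[OF cong_relators(7)[OF e(1)] w1(2) w2(2)] True by simp
    also have "\<dots> \<doteq> word_elem (path_mono [] v p @ path_mono p'' v' [])"
      using cong_word[OF word_left_vertex[OF w2(2,1)] w1(2), of "[]"] w2(3) True by simp
    also have "\<dots> \<doteq> (if p = p'' \<and> v = v' then word_elem [Vertex v] else 0)"
      by (rule Cons.IH[OF e(2) f(2)]) (use Cons.prems p' in simp)
    finally show ?thesis using True p' by simp
  qed
qed

text \<open>How one more letter on the right changes the bound on the ghost length. An edge cancels
  the last ghost letter; if there is none, it extends the path, and for \<open>m = 0\<close>
  truncated subtraction keeps the bound at 0.\<close>

primrec ghost_bound :: "nat \<Rightarrow> ('v, 'e) lpa_gen \<Rightarrow> nat" where
  "ghost_bound m (Vertex v) = m"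
| "ghost_bound m (Edge e) = m - 1"
| "ghost_bound m (Ghost e) = Suc m"

text \<open>A vertex is absorbed, a ghost edge joins the ghost part, and an edge cancels against the
  last ghost letter, annihilates the word or, if no ghost letter is left, extends the path.\<close>

lemma path_mono_mult_gen:
  assumes w: "w \<in> path_monos s u m n" and g: "g \<in> lpa_gens E"
  shows "word_elem (w @ [g]) \<doteq> 0 \<or>
    (\<exists>w' \<in> path_monos s (right_vertex g) (ghost_bound m g) (n + letter_deg g).
      word_elem (w @ [g]) \<doteq> word_elem w')"
proof (cases "left_vertex g = u")
  case False
  then show ?thesis
    using words_mismatch[of w "[g]"] path_monos_word[OF w] g by simp
next
  case True
  obtain p v q where w_eq: "w = path_mono p v q" and p: "awalk s p v" and q: "awalk u q v"
    and m: "length q \<le> m" and n: "int (length p) - int (length q) = n"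
    using w unfolding path_monos_def by blast
  have pX: "set (map Edge p) \<subseteq> lpa_gens E" and p_arcs: "set p \<subseteq> arcs E"
    using p by (auto simp: awalk_def)
  show ?thesis
  proof (cases g)
    case (Vertex x)
    then show ?thesis
      using word_right_vertex[of w] path_monos_word[OF w] w True by auto
  next
    case (Ghost f)
    have "path_mono p v (f # q) \<in> path_monos s (tail E f) (Suc m) (n - 1)"
      using p q m n True Ghost g by (intro path_monosI) (auto simp: awalk_simps)
    moreover have "w @ [g] = path_mono p v (f # q)"
      by (simp add: w_eq Ghost path_mono_def)
    ultimately show ?thesis using Ghost by (intro disjI2) force
  next
    case (Edge f)
    have f: "f \<in> arcs E" "tail E f = u" using g True Edge by auto
    show ?thesis
    proof (cases q)
      case Nil
      have uv: "u = v" using q Nil by (simp add: awalk_simps)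
      \<comment> \<open>The middle vertex \<open>v\<close> is absorbed as the source of
        \<open>f\<close>, and the next congruence puts the range of \<open>f\<close> at the
        end.\<close>
      have "word_elem (w @ [g]) \<doteq> word_elem (map Edge (p @ [f]))"
        using cong_word[OF cong_relators(3)[OF f(1)] pX, of "[]"] Edge Nil f uv
        by (simp add: w_eq path_mono_def)
      also have "\<dots> \<doteq> word_elem (path_mono (p @ [f]) (head E f) [])"
        using cong_sym[OF cong_word[OF cong_relators(4)[OF f(1)] pX, of "[]"]] by (simp add: path_mono_def)
      finally have "word_elem (w @ [g]) \<doteq> word_elem (path_mono (p @ [f]) (head E f) [])" .
      moreover have "path_mono (p @ [f]) (head E f) [] \<in> path_monos s (head E f) (m - 1) (n + 1)"
        using p f uv m n Nil by (intro path_monosI) (auto simp: awalk_simps)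
      ultimately show ?thesis using Edge by (intro disjI2) force
    next
      case (Cons e q')
      have e: "e \<in> arcs E" "awalk (head E e) q' v" using q Cons by (auto simp: awalk_simps)
      note w' = path_mono_word[OF p e(2)]
      have eq: "w @ [g] = path_mono p v q' @ [Ghost e, Edge f]"
        by (simp add: w_eq Edge Cons path_mono_def)
      show ?thesis
      proof (cases "e = f")
        case False
        then show ?thesis
          using cong_word_0[OF cong_relators(8)[OF e(1) f(1) False] w'(2), of "[]"] eq by simp
      next
        case True
        have "word_elem (w @ [g]) \<doteq> word_elem (path_mono p v q' @ [Vertex (head E e)])"
          using cong_word[OF cong_relators(7)[OF e(1)] w'(2), of "[]"] True unfolding eq by simp
        also have "\<dots> \<doteq> word_elem (path_mono p v q')"
          using word_right_vertex[OF w'(2,1)] w'(4) by simp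
        finally have "word_elem (w @ [g]) \<doteq> word_elem (path_mono p v q')" .
        moreover have "path_mono p v q' \<in> path_monos s (head E f) (m - 1) (n + 1)"
          using p e True Cons m n by (intro path_monosI) auto
        ultimately show ?thesis using Edge by (intro disjI2) force
      qed
    qed
  qed
qed

text \<open>Induction from left to right: each new letter is multiplied to the path monomial found
  so far. It raises the ghost length by at most one, so \<open>length w\<close> is a bound.\<close>

lemma word_reduces:
  assumes "w \<noteq> []" "set w \<subseteq> lpa_gens E"
  shows "word_elem w \<doteq> 0 \<or>
    (\<exists>w' \<in> path_monos (left_vertex (hd w)) (right_vertex (last w)) (length w) (word_deg w).
      word_elem w \<doteq> word_elem w')"
  using assms
proof (induction w rule: rev_nonempty_induct)
  case (single g)
  then have g: "g \<in> lpa_gens E" by simp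
  show ?case
  proof (cases g)
    case (Vertex v)
    then have "path_mono [] v [] \<in> path_monos v v 1 0"
      using g by (intro path_monosI) (auto simp: awalk_simps)
    then show ?thesis using Vertex by (intro disjI2) (force simp: path_mono_def)
  next
    case (Edge e)
    then have "path_mono [e] (head E e) [] \<in> path_monos (tail E e) (head E e) 1 1"
      using g by (intro path_monosI) (auto simp: awalk_simps)
    moreover have "word_elem [e'] \<doteq> word_elem (path_mono [e] (head E e) [])" if "e' = Edge e" for e'
      using cong_sym[OF cong_relators(4)] g Edge that by (simp add: path_mono_def)
    ultimately show ?thesis using Edge by (intro disjI2) force
  next
    case (Ghost e)
    then have "path_mono [] (head E e) [e] \<in> path_monos (head E e) (tail E e) 1 (- 1)"
      using g by (intro path_monosI) (auto simp: awalk_simps)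
    moreover have "word_elem [e'] \<doteq> word_elem (path_mono [] (head E e) [e])" if "e' = Ghost e" for e'
      using cong_sym[OF cong_relators(5)] g Ghost that by (simp add: path_mono_def)
    ultimately show ?thesis using Ghost by (intro disjI2) force
  qed
next
  case (snoc g w)
  then have w: "set w \<subseteq> lpa_gens E" and g: "g \<in> lpa_gens E" by auto
  let ?s = "left_vertex (hd w)" and ?u = "right_vertex (last w)"
  from snoc.IH[OF w] show ?case
  proof
    assume "word_elem w \<doteq> (0 :: _ \<Rightarrow>\<^sub>0 'k)"
    from cong_word_0[OF this, of "[]" "[g]"] g show ?thesis by simp
  next
    assume "\<exists>w' \<in> path_monos ?s ?u (length w) (word_deg w). word_elem w \<doteq> (word_elem w' :: _ \<Rightarrow>\<^sub>0 'k)"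
    then obtain w' where w': "w' \<in> path_monos ?s ?u (length w) (word_deg w)"
      and eq: "word_elem w \<doteq> (word_elem w' :: _ \<Rightarrow>\<^sub>0 'k)" by blast
    have eq': "word_elem (w @ [g]) \<doteq> (word_elem (w' @ [g]) :: _ \<Rightarrow>\<^sub>0 'k)"
      using cong_word[OF eq, of "[]" "[g]"] g by simp
    have "ghost_bound (length w) g \<le> length (w @ [g])" by (cases g) auto
    note mono = path_monos_mono[OF this]
    from path_mono_mult_gen[OF w' g] show ?thesis
    proof (elim disjE bexE)
      assume "word_elem (w' @ [g]) \<doteq> 0"
      then show ?thesis using cong_trans[OF eq'] by blast
    next
      fix w'' assume w'': "w'' \<in> path_monos ?s (right_vertex g) (ghost_bound (length w) g) (word_deg w + letter_deg g)"
        and "word_elem (w' @ [g]) \<doteq> word_elem w''"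
      then have "word_elem (w @ [g]) \<doteq> word_elem w''" using cong_trans[OF eq'] by blast
      moreover have "w'' \<in> path_monos (left_vertex (hd (w @ [g]))) (right_vertex (last (w @ [g])))
          (length (w @ [g])) (word_deg (w @ [g]))"
        using subsetD[OF mono w''] snoc.hyps by simp
      ultimately show ?thesis by blast
    qed
  qed
qed

section \<open>Homogeneous ideals are generated by vertices\<close>

text \<open>The ideals of the free algebra that contain the relators correspond to the ideals of \<open>L\<^sub>K(E)\<close>.\<close>

definition overideal :: "(('v, 'e) lpa_gen list \<Rightarrow>\<^sub>0 'k) set \<Rightarrow> bool" where
  "overideal J \<longleftrightarrow> ideal_of (free_alg (lpa_gens E)) J \<and> lpa_ideal E \<subseteq> J"

lemma overidealD:
  assumes "overideal J"
  shows "free_alg_ideal (lpa_gens E) J" "x \<in> lpa_ideal E \<Longrightarrow> x \<in> J" "x \<doteq> y \<Longrightarrow> y \<in> J \<Longrightarrow> x \<in> J"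
proof -
  show J: "free_alg_ideal (lpa_gens E) J"
    using assms unfolding overideal_def free_alg_ideal_def by simp
  show sub: "x \<in> J" if "x \<in> lpa_ideal E" for x
    using assms that unfolding overideal_def by auto
  show "x \<in> J" if "x \<doteq> y" "y \<in> J"
    using free_alg_ideal.add[OF J, of "x - y" y] sub[of "x - y"] that
    by (simp add: lpa_cong_def)
qed

text \<open>Reductions of single words combine linearly, since scalar factors do not enlarge
  supports.\<close>

lemma mult_word_reduces:
  assumes "\<forall>w \<in> Poly_Mapping.keys y. word_elem (w @ b) \<doteq> 0 \<or> (\<exists>w'\<in>S. word_elem (w @ b) \<doteq> word_elem w')"
  shows "\<exists>z. Poly_Mapping.keys z \<subseteq> S \<and> y * word_elem b \<doteq> z"
proof -
  have "\<exists>z. Poly_Mapping.keys z \<subseteq> S \<and> word_elem (w @ b) \<doteq> z" if "w \<in> Poly_Mapping.keys y" for w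
    using bspec[OF assms that]
  proof (elim disjE bexE)
    assume "word_elem (w @ b) \<doteq> 0"
    then show ?thesis by (intro exI[of _ 0]) simp
  next
    fix w' assume "w' \<in> S" "word_elem (w @ b) \<doteq> word_elem w'"
    then show ?thesis by (intro exI[of _ "word_elem w'"]) simp
  qed
  then obtain f where f: "\<And>w. w \<in> Poly_Mapping.keys y \<Longrightarrow> Poly_Mapping.keys (f w) \<subseteq> S"
      "\<And>w. w \<in> Poly_Mapping.keys y \<Longrightarrow> word_elem (w @ b) \<doteq> f w"
    by metis
  let ?z = "\<Sum>w\<in>Poly_Mapping.keys y. Poly_Mapping.single [] (Poly_Mapping.lookup y w) * f w"
  have "y * word_elem b =
      (\<Sum>w\<in>Poly_Mapping.keys y. Poly_Mapping.single [] (Poly_Mapping.lookup y w) * word_elem (w @ b))"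
    by (subst (1) poly_mapping_sum_single[of y]) (simp add: sum_distrib_right single_append)
  also have "\<dots> \<doteq> ?z"
    by (intro cong_sum cong_single_left f) auto
  finally have "y * word_elem b \<doteq> ?z" .
  moreover have "Poly_Mapping.keys (Poly_Mapping.single [] c * f w) \<subseteq> S"
    if "w \<in> Poly_Mapping.keys y" for w c
    using keys_mult[of "Poly_Mapping.single [] c" "f w"] f(1)[OF that]
    by (auto simp: plus_list_def split: if_splits)
  then have "Poly_Mapping.keys ?z \<subseteq> S"
    using keys_sum by fast
  ultimately show ?thesis by blast
qed

text \<open>A substitute for the unit: the finitely many right end vertices of the words of
  \<open>x\<close> have a sum that fixes \<open>x\<close> from the right, modulo
  \<open>lpa_ideal E\<close>.\<close>

lemma mem_overideal_if_vertices:
  assumes K: "overideal K" and x: "x \<in> Carrier (free_alg (lpa_gens E))"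
    and xv: "\<And>v. v \<in> verts E \<Longrightarrow> x * word_elem [Vertex v] \<in> K"
  shows "x \<in> K"
proof -
  interpret K: free_alg_ideal "lpa_gens E" K by (rule overidealD[OF K])
  let ?c = "Poly_Mapping.lookup x" and ?r = "\<lambda>w. right_vertex (last w)"
  let ?V = "?r ` Poly_Mapping.keys x"
  have w: "w \<noteq> []" "set w \<subseteq> lpa_gens E" "?r w \<in> verts E" if "w \<in> Poly_Mapping.keys x" for w
    using x that gen_vertices(2)[of "last w"] last_in_set[of w] unfolding carrier_free_alg by blast+
  have "(\<Sum>v\<in>?V. x * word_elem [Vertex v]) =
      (\<Sum>w\<in>Poly_Mapping.keys x. \<Sum>v\<in>?V. Poly_Mapping.single w (?c w) * word_elem [Vertex v])"
    by (subst sum.swap, subst (1) poly_mapping_sum_single[of x]) (simp add: sum_distrib_right)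
  also have "\<dots> \<doteq> (\<Sum>w\<in>Poly_Mapping.keys x. \<Sum>v\<in>?V. if v = ?r w then Poly_Mapping.single w (?c w) else 0)"
  proof (intro cong_sum)
    fix w v assume "w \<in> Poly_Mapping.keys x" and "v \<in> ?V"
    then have *: "w \<noteq> []" "set w \<subseteq> lpa_gens E" "v \<in> verts E" using w by auto
    \<comment> \<open>Each word is fixed by its own right end vertex and killed by every other
      one.\<close>
    have "word_elem (w @ [Vertex v]) \<doteq> (if v = ?r w then word_elem w else 0)"
      using word_right_vertex[OF *(2,1)] words_mismatch[OF *(2,1), of "[Vertex v]"] * by auto
    from cong_single_left[OF this, of "[]" "?c w"]
    show "Poly_Mapping.single w (?c w) * word_elem [Vertex v] \<doteq>
        (if v = ?r w then Poly_Mapping.single w (?c w) else 0)"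
      by (simp add: single_append if_distrib cong: if_cong)
  qed
  also have "\<dots> = (\<Sum>w\<in>Poly_Mapping.keys x. Poly_Mapping.single w (?c w))"
    by (intro sum.cong refl) (simp add: sum.delta')
  also have "\<dots> = x" by (rule poly_mapping_sum_single[symmetric])
  finally have "x \<doteq> (\<Sum>v\<in>?V. x * word_elem [Vertex v])" by (rule cong_sym)
  then show ?thesis
    by (rule overidealD(3)[OF K], intro K.sum xv) (use w(3) in blast)
qed

text \<open>Base case without ghost edges. All paths in the support have the same length, so a ghost
  path multiplied from the left isolates one coefficient, at the range of that path.\<close>

lemma homogeneous_paths_in_overideal:
  assumes J: "overideal J" and K: "overideal K"
    and V: "\<And>v. v \<in> verts E \<Longrightarrow> word_elem [Vertex v] \<in> J \<Longrightarrow> word_elem [Vertex v] \<in> K"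
    and y: "y \<in> J" "Poly_Mapping.keys y \<subseteq> (\<Union>s u. path_monos s u 0 n)"
  shows "y \<in> K"
proof -
  interpret J: free_alg_ideal "lpa_gens E" J by (rule overidealD[OF J])
  interpret K: free_alg_ideal "lpa_gens E" K by (rule overidealD[OF K])
  let ?c = "Poly_Mapping.lookup y"
  have keys: "\<exists>s p v. w = path_mono p v [] \<and> awalk s p v \<and> int (length p) = n"
    if wy: "w \<in> Poly_Mapping.keys y" for w
  proof -
    obtain s u where "w \<in> path_monos s u 0 n" using subsetD[OF y(2) wy] by blast
    then show ?thesis unfolding path_monos_def by auto
  qed
  have "Poly_Mapping.single w (?c w) \<in> K" if wy: "w \<in> Poly_Mapping.keys y" for w
  proof -
    obtain s p v where w: "w = path_mono p v []" and p: "awalk s p v" "int (length p) = n"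
      using keys[OF wy] by blast
    have v: "v \<in> verts E" "awalk v [] v" using p(1) by (auto simp: awalk_Nil_iff dest: awalk_last_in_verts)
    note w_word = path_mono_word[OF p(1) v(2)] and star = path_mono_word[OF v(2) p(1)]
    have "word_elem (path_mono [] v p) * y =
        (\<Sum>w'\<in>Poly_Mapping.keys y. Poly_Mapping.single [] (?c w') * word_elem (path_mono [] v p @ w'))"
      by (subst (1) poly_mapping_sum_single[of y]) (simp add: sum_distrib_left single_append)
    also have "\<dots> \<doteq> (\<Sum>w'\<in>Poly_Mapping.keys y. Poly_Mapping.single [] (?c w') * (if w' = w then word_elem [Vertex v] else 0))"
    proof (intro cong_sum cong_single_left)
      fix w' assume "w' \<in> Poly_Mapping.keys y"
      then obtain s' p' v' where w': "w' = path_mono p' v' []" and p': "awalk s' p' v'" "int (length p') = n"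
        using keys by blast
      have "(p = p' \<and> v = v') = (w' = w)"
        using p(2) p'(2) by (auto simp: w w' path_mono_def map_eq_conv inj_map_eq_map inj_on_def)
      then show "word_elem (path_mono [] v p @ w') \<doteq> (if w' = w then word_elem [Vertex v] else 0)"
        using ghost_path_mult_path[OF p(1) p'(1)] p(2) p'(2) by (simp add: w')
    qed simp
    also have "\<dots> = Poly_Mapping.single [Vertex v] (?c w)"
      using wy by (simp add: if_distrib single_append sum.delta cong: if_cong)
    finally have "Poly_Mapping.single [Vertex v] (?c w) \<doteq> word_elem (path_mono [] v p) * y"
      by (rule cong_sym)
    then have "Poly_Mapping.single [Vertex v] (?c w) \<in> J"
      by (rule overidealD(3)[OF J]) (intro J.single_left y star)
    \<comment> \<open>The coefficient is invertible because \<open>w\<close> lies in the support of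
      \<open>y\<close>.\<close>
    from J.scale[OF this, of "inverse (?c w)"] have "word_elem [Vertex v] \<in> J"
      using wy by (simp add: single_append in_keys_iff)
    \<comment> \<open>The vertex passes to \<open>K\<close> by assumption \<open>V\<close>, and
      multiplying the path back on gives the term of \<open>w\<close>.\<close>
    then have "Poly_Mapping.single (map Edge p) (?c w) * word_elem [Vertex v] \<in> K"
      using V[OF v(1)] w_word(2) by (intro K.single_left) (auto simp: path_mono_def)
    then show ?thesis by (simp add: w path_mono_def single_append)
  qed
  then have "(\<Sum>w\<in>Poly_Mapping.keys y. Poly_Mapping.single w (?c w)) \<in> K" by (rule K.sum)
  then show ?thesis by (simp only: poly_mapping_sum_single[of y, symmetric])
qed

text \<open>
  Induction on the length of the ghost part: multiplying on the right by edges shortens it, and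
  the relation \<open>v = \<Sum> e e\<^sup>*\<close> recovers the element.  At a sink the ghost part is already trivial.
\<close>

lemma homogeneous_monos_in_overideal:
  assumes J: "overideal J" and K: "overideal K"
    and V: "\<And>v. v \<in> verts E \<Longrightarrow> word_elem [Vertex v] \<in> J \<Longrightarrow> word_elem [Vertex v] \<in> K"
  shows "y \<in> J \<Longrightarrow> Poly_Mapping.keys y \<subseteq> (\<Union>s u. path_monos s u m n) \<Longrightarrow> y \<in> K"
proof (induction m arbitrary: n y)
  case 0
  then show ?case using homogeneous_paths_in_overideal[OF J K V] by blast
next
  case (Suc m)
  interpret J: free_alg_ideal "lpa_gens E" J by (rule overidealD[OF J])
  interpret K: free_alg_ideal "lpa_gens E" K by (rule overidealD[OF K])
  have keys: "\<exists>s u. w \<in> path_monos s u (Suc m) n" if "w \<in> Poly_Mapping.keys y" for w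
    using that Suc.prems(2) by blast
  show ?case
  \<comment> \<open>The relation that expands a vertex is applied at one vertex at a time.\<close>
  proof (rule mem_overideal_if_vertices[OF K J.closed[OF Suc.prems(1)]])
    fix v assume v: "v \<in> verts E"
    show "y * word_elem [Vertex v] \<in> K"
    proof (cases "out_arcs E v = {}")
      case False
      then have "v \<in> regular_verts E"
        using v row_finite by (simp add: regular_verts_def row_finite_def)
      from cong_relators(9)[OF this]
      have cong: "y * word_elem [Vertex v] \<doteq> y * (\<Sum>e \<in> out_arcs E v. word_elem [Edge e, Ghost e])"
        using lpa_ideal.mult_left[OF _ J.closed[OF Suc.prems(1)]]
        by (simp add: lpa_cong_def flip: right_diff_distrib)
      have "y * word_elem [Edge e, Ghost e] \<in> K" if "e \<in> out_arcs E v" for e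
      proof -
        have e: "e \<in> arcs E" using that by simp
        \<comment> \<open>Multiplying by the edge lowers the ghost bound to \<open>m\<close> and
          raises the degree by one, so the induction hypothesis is used in degree
          \<open>n + 1\<close>.\<close>
        have "\<exists>z. Poly_Mapping.keys z \<subseteq> (\<Union>s u. path_monos s u m (n + 1)) \<and> y * word_elem [Edge e] \<doteq> z"
        proof (intro mult_word_reduces ballI)
          fix w assume "w \<in> Poly_Mapping.keys y"
          then obtain s u where "w \<in> path_monos s u (Suc m) n" using keys by blast
          from path_mono_mult_gen[OF this, of "Edge e"] e
          show "word_elem (w @ [Edge e]) \<doteq> 0 \<or>
              (\<exists>w'\<in>\<Union>s u. path_monos s u m (n + 1). word_elem (w @ [Edge e]) \<doteq> word_elem w')"
            by auto
        qed
        then obtain z where z: "Poly_Mapping.keys z \<subseteq> (\<Union>s u. path_monos s u m (n + 1))"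
          "y * word_elem [Edge e] \<doteq> z" by blast
        have "z \<in> J"
          using overidealD(3)[OF J cong_sym[OF z(2)]] J.single_right[OF Suc.prems(1), of "[Edge e]"] e by simp
        then have "z \<in> K" using Suc.IH z(1) by blast
        then have "y * word_elem [Edge e] \<in> K" using overidealD(3)[OF K z(2)] by blast
        then have "y * word_elem [Edge e] * word_elem [Ghost e] \<in> K"
          by (rule K.single_right) (use e in simp)
        then show ?thesis by (simp add: mult.assoc single_append)
      qed
      then have "(\<Sum>e\<in>out_arcs E v. y * word_elem [Edge e, Ghost e]) \<in> K" by (rule K.sum)
      then show ?thesis using overidealD(3)[OF K cong] by (simp add: sum_distrib_left)
    next
      case True
      have "\<exists>z. Poly_Mapping.keys z \<subseteq> (\<Union>s u. path_monos s u 0 n) \<and> y * word_elem [Vertex v] \<doteq> z"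
      proof (intro mult_word_reduces ballI)
        fix w assume "w \<in> Poly_Mapping.keys y"
        then obtain s u where w: "w \<in> path_monos s u (Suc m) n" using keys by blast
        show "word_elem (w @ [Vertex v]) \<doteq> 0 \<or>
            (\<exists>w'\<in>\<Union>s u. path_monos s u 0 n. word_elem (w @ [Vertex v]) \<doteq> word_elem w')"
        proof (cases "u = v")
          case False
          then show ?thesis using words_mismatch[of w "[Vertex v]"] path_monos_word[OF w] v by simp
        next
          case uv: True
          \<comment> \<open>The ghost part is a path that starts at the sink \<open>v\<close>, so it
            is trivial.\<close>
          have sink: "length q = 0" if "awalk u q x" for q x
            using that True uv by (cases q) (auto simp: awalk_simps out_arcs_def)
          obtain p x q where "w = path_mono p x q" "awalk s p x" "awalk u q x"
            "int (length p) - int (length q) = n"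
            using w unfolding path_monos_def by blast
          then have "w \<in> path_monos s u 0 n" using sink[of q x] by (simp add: path_monosI)
          moreover have "word_elem (w @ [Vertex v]) \<doteq> word_elem w"
            using word_right_vertex[of w] path_monos_word[OF w] uv by simp
          ultimately show ?thesis by blast
        qed
      qed
      then obtain z where z: "Poly_Mapping.keys z \<subseteq> (\<Union>s u. path_monos s u 0 n)"
        "y * word_elem [Vertex v] \<doteq> z" by blast
      have "z \<in> J"
        using overidealD(3)[OF J cong_sym[OF z(2)]] J.single_right[OF Suc.prems(1), of "[Vertex v]"] v by simp
      then have "z \<in> K" using homogeneous_paths_in_overideal[OF J K V _ z(1)] by blast
      then show ?thesis using overidealD(3)[OF K z(2)] by blast
    qed
  qed
qed

text \<open>Gradedness permits treating one component at a time. Its words reduce to path monomials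
  of one degree, to which the induction on the ghost length applies.\<close>

theorem graded_overideal_subset:
  assumes J: "overideal J" and K: "overideal K"
    and V: "\<And>v. v \<in> verts E \<Longrightarrow> word_elem [Vertex v] \<in> J \<Longrightarrow> word_elem [Vertex v] \<in> K"
    and graded: "\<And>x n. x \<in> J \<Longrightarrow> deg_part n x \<in> J"
  shows "J \<subseteq> K"
proof
  fix x assume x: "x \<in> J"
  interpret J: free_alg_ideal "lpa_gens E" J by (rule overidealD[OF J])
  interpret K: free_alg_ideal "lpa_gens E" K by (rule overidealD[OF K])
  have "deg_part n x \<in> K" for n
  proof -
    \<comment> \<open>\<open>word_reduces\<close> bounds the ghost length of a reduct by the length
      of the word, so the longest word of \<open>x\<close> bounds them all.\<close>
    define m where "m = Max (length ` Poly_Mapping.keys x)"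
    \<comment> \<open>The empty word is the unit of the surrounding ring; with it
      \<open>mult_word_reduces\<close> applies to the component itself.\<close>
    have "\<exists>z. Poly_Mapping.keys z \<subseteq> (\<Union>s u. path_monos s u m n) \<and> deg_part n x * word_elem [] \<doteq> z"
    proof (intro mult_word_reduces ballI)
      fix w assume "w \<in> Poly_Mapping.keys (deg_part n x)"
      then have w: "w \<in> Poly_Mapping.keys x" "word_deg w = n" by (auto simp: keys_deg_part)
      then have "w \<noteq> []" "set w \<subseteq> lpa_gens E" "length w \<le> m"
        using J.closed[OF x] by (auto simp: carrier_free_alg m_def)
      with word_reduces[of w] w(2) path_monos_mono[of "length w" m]
      show "word_elem (w @ []) \<doteq> 0 \<or> (\<exists>w'\<in>\<Union>s u. path_monos s u m n. word_elem (w @ []) \<doteq> word_elem w')"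
        by auto blast
    qed
    then obtain z where z: "Poly_Mapping.keys z \<subseteq> (\<Union>s u. path_monos s u m n)" "deg_part n x \<doteq> z"
      by (auto simp flip: zero_list_def)
    have "z \<in> J" using overidealD(3)[OF J cong_sym[OF z(2)]] graded[OF x] by blast
    then have "z \<in> K" using homogeneous_monos_in_overideal[OF J K V _ z(1)] by blast
    then show ?thesis using overidealD(3)[OF K z(2)] by blast
  qed
  then have "(\<Sum>n \<in> word_deg ` Poly_Mapping.keys x. deg_part n x) \<in> K" by (intro K.sum)
  then show "x \<in> K" by (simp only: sum_deg_part[of x, symmetric])
qed

text \<open>The elements of \<open>lpa_ideal E\<close> all of whose components stay inside form an
  ideal. It contains the relators, each being homogeneous, and hence the ideal that they
  generate.\<close>

lemma deg_part_lpa_ideal: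
  assumes "x \<in> (lpa_ideal E :: (('v, 'e) lpa_gen list \<Rightarrow>\<^sub>0 'k) set)"
  shows "deg_part n x \<in> lpa_ideal E"
proof -
  let ?I = "{p \<in> lpa_ideal E. \<forall>n. deg_part n p \<in> (lpa_ideal E :: (('v, 'e) lpa_gen list \<Rightarrow>\<^sub>0 'k) set)}"
  have "ideal_of (free_alg (lpa_gens E)) ?I"
    by (rule ideal_of_free_algI)
      (auto simp: deg_part_single_mult intro: lpa_ideal.closed lpa_ideal.zero lpa_ideal.add
        lpa_ideal.single_left lpa_ideal.single_right)
  moreover have "r \<in> ?I" if "r \<in> lpa_relators E" for r
  proof -
    have "\<exists>m. \<forall>n. deg_part n r = (if n = m then r else 0)"
      using that unfolding lpa_relators_def Un_iff mem_Collect_eq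
      by (elim disjE exE conjE)
        (force simp: deg_part_sum deg_part_single)+
    then show ?thesis using relator_in_lpa_ideal[OF that] lpa_ideal.zero by auto
  qed
  ultimately have "lpa_ideal E \<subseteq> ?I"
    unfolding lpa_ideal_def gen_ideal_def by blast
  then show ?thesis using assms by blast
qed

section \<open>The vertices are nonzero\<close>

text \<open>
  \<open>L\<^sub>K(E)\<close> acts on the functions \<open>E\<^sup>0 \<times> \<nat> \<rightarrow> K\<close>.  For a regular vertex \<open>u\<close> a bijection of \<open>{u} \<times> \<nat>\<close> with
  \<open>s\<inverse>(u) \<times> \<nat>\<close> identifies the functions on \<open>{u} \<times> \<nat>\<close> with the direct sum, over the edges \<open>e\<close>
  leaving \<open>u\<close>, of the functions on \<open>{r(e)} \<times> \<nat>\<close>; the edges act as the inclusions and the ghost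
  edges as the projections.
\<close>


definition branch_code :: "'v \<Rightarrow> 'e \<times> nat \<Rightarrow> nat" where
  "branch_code u = to_nat_on (out_arcs E u \<times> UNIV)"

definition branch :: "'v \<Rightarrow> nat \<Rightarrow> 'e \<times> nat" where
  "branch u = from_nat_into (out_arcs E u \<times> UNIV)"

lemma countable_branches: "v \<in> verts E \<Longrightarrow> countable (out_arcs E v \<times> (UNIV :: nat set))"
  using row_finite by (auto simp: row_finite_def intro: countable_finite)

lemma branch_branch_code: "e \<in> arcs E \<Longrightarrow> branch (tail E e) (branch_code (tail E e) (e, n)) = (e, n)"
  unfolding branch_def branch_code_def
  by (rule from_nat_into_to_nat_on[OF countable_branches]) (auto simp: out_arcs_def)

text \<open>Because of the factor \<open>UNIV\<close> a regular vertex has infinitely many branches;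
  hence the code takes every natural number as a value.\<close>

lemma branch_regular:
  assumes "v \<in> regular_verts E"
  shows "fst (branch v n) \<in> out_arcs E v" "branch_code v (branch v n) = n"
proof -
  have v: "v \<in> verts E" "out_arcs E v \<noteq> {}" using assms by (auto simp: regular_verts_def)
  have ne: "out_arcs E v \<times> (UNIV :: nat set) \<noteq> {}" using v by simp
  from from_nat_into[OF ne, of n] show "fst (branch v n) \<in> out_arcs E v"
    unfolding branch_def by (auto simp: mem_Times_iff)
  have "infinite (out_arcs E v \<times> (UNIV :: nat set))"
    using v by (simp add: finite_cartesian_product_iff)
  then show "branch_code v (branch v n) = n"
    unfolding branch_def branch_code_def by (simp add: countable_branches[OF v(1)])
qed

section \<open>The action on functions\<close>

primrec gen_act :: "('v, 'e) lpa_gen \<Rightarrow> ('v \<times> nat \<Rightarrow> 'k) \<Rightarrow> 'v \<times> nat \<Rightarrow> 'k" where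
  "gen_act (Vertex v) f = (\<lambda>(u, n). if u = v then f (u, n) else 0)"
| "gen_act (Edge e) f =
    (\<lambda>(u, n). if u = tail E e \<and> fst (branch u n) = e then f (head E e, snd (branch u n)) else 0)"
| "gen_act (Ghost e) f =
    (\<lambda>(u, n). if u = head E e then f (tail E e, branch_code (tail E e) (e, n)) else 0)"

lemma gen_act_linear:
  "gen_act g (\<lambda>x. 0) = (\<lambda>x. 0)"
  "gen_act g (\<lambda>x. f x + h x) = (\<lambda>x. gen_act g f x + gen_act g h x)"
  "gen_act g (\<lambda>x. c * f x) = (\<lambda>x. c * gen_act g f x)"
  by (cases g; auto simp: fun_eq_iff)+

text \<open>The leftmost letter acts last, so that concatenation of words becomes composition of
  operators.\<close>

abbreviation word_act :: "('v, 'e) lpa_gen list \<Rightarrow> ('v \<times> nat \<Rightarrow> 'k) \<Rightarrow> 'v \<times> nat \<Rightarrow> 'k" where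
  "word_act w \<equiv> foldr gen_act w"

lemma word_act_linear:
  "word_act w (\<lambda>x. 0) = (\<lambda>x. 0)"
  "word_act w (\<lambda>x. f x + h x) = (\<lambda>x. word_act w f x + word_act w h x)"
  "word_act w (\<lambda>x. c * f x) = (\<lambda>x. c * word_act w f x)"
  by (induction w) (simp_all add: gen_act_linear)

definition poly_act :: "(('v, 'e) lpa_gen list \<Rightarrow>\<^sub>0 'k) \<Rightarrow> ('v \<times> nat \<Rightarrow> 'k) \<Rightarrow> 'v \<times> nat \<Rightarrow> 'k" where
  "poly_act p f = (\<lambda>x. \<Sum>w\<in>Poly_Mapping.keys p. Poly_Mapping.lookup p w * word_act w f x)"

text \<open>Sums over the supports of different polynomials become comparable over one finite set of
  words, which gives additivity of the action.\<close>

lemma poly_act_superset: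
  assumes "finite S" "Poly_Mapping.keys p \<subseteq> S"
  shows "poly_act p f x = (\<Sum>w\<in>S. Poly_Mapping.lookup p w * word_act w f x)"
  unfolding poly_act_def using assms
  by (intro sum.mono_neutral_left) (auto simp: in_keys_iff)

lemma poly_act_0 [simp]: "poly_act 0 f = (\<lambda>x. 0)"
  by (simp add: poly_act_def)

lemma poly_act_single [simp]: "poly_act (Poly_Mapping.single w c) f = (\<lambda>x. c * word_act w f x)"
  by (rule ext) (subst poly_act_superset[of "{w}"], auto split: if_splits)

lemma poly_act_add [simp]: "poly_act (p + q) f = (\<lambda>x. poly_act p f x + poly_act q f x)"
proof
  fix x
  let ?S = "Poly_Mapping.keys p \<union> Poly_Mapping.keys q"
  show "poly_act (p + q) f x = poly_act p f x + poly_act q f x"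
    using keys_add[of p q]
    by (simp add: poly_act_superset[of ?S] lookup_add distrib_right sum.distrib)
qed

lemma poly_act_diff [simp]: "poly_act (p - q) f = (\<lambda>x. poly_act p f x - poly_act q f x)"
  using poly_act_add[of "p - q" q f] by (simp add: fun_eq_iff algebra_simps del: poly_act_add)

lemma poly_act_sum: "poly_act (sum p S) f = (\<lambda>x. \<Sum>i\<in>S. poly_act (p i) f x)"
  by (induction S rule: infinite_finite_induct) simp_all

text \<open>Monomial factors suffice here, since \<open>ideal_of_free_algI\<close> tests closure
  against monomials.\<close>

lemma poly_act_single_mult:
  "poly_act (Poly_Mapping.single w c * p) f = (\<lambda>x. c * word_act w (poly_act p f) x)"
  "poly_act (p * Poly_Mapping.single w c) f = (\<lambda>x. c * poly_act p (word_act w f) x)"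
  by (induction p rule: poly_mapping_additive_induct)
    (auto simp: single_append word_act_linear fun_eq_iff distrib_left distrib_right mult_ac)

lemma poly_act_relator:
  assumes "r \<in> lpa_relators E"
  shows "poly_act r f = (\<lambda>x. 0)"
proof -
  \<comment> \<open>At \<open>(v, n)\<close> only the edge \<open>fst (branch v n)\<close>
    contributes, and it returns \<open>f (v, n)\<close> because the code undoes
    \<open>branch\<close>.\<close>
  have CK2: "(\<Sum>e\<in>out_arcs E v. gen_act (Edge e) (gen_act (Ghost e) f) (u, n)) = gen_act (Vertex v) f (u, n)"
    if v: "v \<in> regular_verts E" for u v n
  proof (cases "u = v")
    case True
    have fin: "finite (out_arcs E v)" using v by (simp add: regular_verts_def)
    note b = branch_regular[OF v, of n]
    have "(\<Sum>e\<in>out_arcs E v. gen_act (Edge e) (gen_act (Ghost e) f) (u, n)) =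
        (\<Sum>e\<in>out_arcs E v. if e = fst (branch v n) then f (v, n) else 0)"
    proof (rule sum.cong[OF refl])
      fix e assume e: "e \<in> out_arcs E v"
      have "branch_code v (e, snd (branch v n)) = n" if "fst (branch v n) = e"
        using b(2) that by (metis prod.collapse)
      then show "gen_act (Edge e) (gen_act (Ghost e) f) (u, n) =
          (if e = fst (branch v n) then f (v, n) else 0)"
        using True e b(2) by auto
    qed
    also have "\<dots> = f (v, n)" using fin b(1) by (simp add: sum.delta)
    finally show ?thesis using True by simp
  next
    case False
    then show ?thesis by (auto intro!: sum.neutral)
  qed
  show ?thesis
    using assms unfolding lpa_relators_def Un_iff mem_Collect_eq
    by (elim disjE exE conjE)
      ((simp add: fun_eq_iff poly_act_sum CK2 del: gen_act.simps; fail) |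
        (auto simp: fun_eq_iff branch_branch_code split: if_splits; fail))+
qed

text \<open>The elements that act as zero form an ideal containing the relators, so all of
  \<open>lpa_ideal E\<close> acts as zero. But \<open>v\<close> takes the constant function 1 to a
  function with value 1 at \<open>(v, 0)\<close>.\<close>

theorem vertex_not_in_lpa_ideal: "word_elem [Vertex v] \<notin> (lpa_ideal E :: (_ \<Rightarrow>\<^sub>0 'k) set)"
proof
  assume v: "word_elem [Vertex v] \<in> (lpa_ideal E :: (_ \<Rightarrow>\<^sub>0 'k) set)"
  let ?I = "{p \<in> Carrier (free_alg (lpa_gens E)). \<forall>f. poly_act p f = (\<lambda>x. 0)}"
  interpret F: nonunital_algebra "free_alg (lpa_gens E) :: ('k, _) nalg"
    by (rule free_alg_nonunital_algebra)
  have "free_alg_ideal (lpa_gens E) (Carrier (free_alg (lpa_gens E)) :: (_ \<Rightarrow>\<^sub>0 'k) set)"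
    unfolding free_alg_ideal_def ideal_of_def subspace_of_def
    using F.zero_closed F.add_closed F.scale_closed F.mult_closed by auto
  then interpret C: free_alg_ideal "lpa_gens E" "Carrier (free_alg (lpa_gens E)) :: (_ \<Rightarrow>\<^sub>0 'k) set" .
  have "ideal_of (free_alg (lpa_gens E)) ?I"
    by (rule ideal_of_free_algI)
      (auto simp: poly_act_single_mult word_act_linear intro: C.zero C.add C.single_left C.single_right)
  moreover have "lpa_relators E \<subseteq> ?I"
    using lpa_relators_closed[OF wf_digraph_axioms] poly_act_relator by blast
  ultimately have "lpa_ideal E \<subseteq> ?I"
    unfolding lpa_ideal_def gen_ideal_def by blast
  then have "poly_act (word_elem [Vertex v]) (\<lambda>x. 1) = (\<lambda>x. 0)"
    using v by blast
  from fun_cong[OF this, of "(v, 0)"] show False by simp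
qed

section \<open>Annihilators of graded ideals\<close>


text \<open>With \<open>u\<close> the ideal contains \<open>u p = p\<close>, and with
  \<open>p\<close> it contains \<open>p* p = v\<close>.\<close>

lemma overideal_hereditary:
  assumes P: "overideal P" and p: "awalk u p v" and u: "word_elem [Vertex u] \<in> P"
  shows "word_elem [Vertex v] \<in> P"
proof -
  interpret P: free_alg_ideal "lpa_gens E" P by (rule overidealD[OF P])
  have v: "awalk v [] v" using p by (auto simp: awalk_Nil_iff dest: awalk_last_in_verts)
  note path = path_mono_word[OF p v] and star = path_mono_word[OF v p]
  have "word_elem [Vertex u] * word_elem (path_mono p v []) \<in> P"
    by (rule P.single_right[OF u path(2)])
  then have "word_elem (path_mono p v []) \<in> P"
    using overidealD(3)[OF P cong_sym[OF word_left_vertex[OF path(2,1)]]] path(3)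
    by (simp add: single_append)
  then have "word_elem (path_mono [] v p) * word_elem (path_mono p v []) \<in> P"
    by (rule P.single_left[OF _ star(2)])
  then show ?thesis
    using overidealD(3)[OF P cong_sym[OF ghost_path_mult_path[OF p p refl]]] by (simp add: single_append)
qed

text \<open>A word that does not reduce to 0 reduces to a path monomial, whose two paths would start
  at \<open>a\<close> and \<open>b\<close> and share their range.\<close>

lemma disjoint_trees_word:
  assumes "\<And>p q x. awalk a p x \<Longrightarrow> awalk b q x \<Longrightarrow> False"
    and "a \<in> verts E" "b \<in> verts E" "set w \<subseteq> lpa_gens E"
  shows "word_elem (Vertex a # w @ [Vertex b]) \<doteq> 0"
  using word_reduces[of "Vertex a # w @ [Vertex b]"] assms
  by (fastforce simp: path_monos_def)

text \<open>The annihilator in the quotient in terms of representatives, so products are only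
  required to vanish modulo \<open>lpa_ideal E\<close>.\<close>

definition annihilator :: "(('v, 'e) lpa_gen list \<Rightarrow>\<^sub>0 'k) set \<Rightarrow> (('v, 'e) lpa_gen list \<Rightarrow>\<^sub>0 'k) set" where
  "annihilator P = {a \<in> Carrier (free_alg (lpa_gens E)). \<forall>x\<in>P. a * x \<in> lpa_ideal E \<and> x * a \<in> lpa_ideal E}"

text \<open>Viewing the whole algebra as an ideal of itself makes the closure rules of
  \<open>free_alg_ideal\<close> available for membership in the carrier.\<close>

lemma free_alg_ideal_carrier:
  "free_alg_ideal X (Carrier (free_alg X) :: ('x list \<Rightarrow>\<^sub>0 'k) set)"
proof -
  interpret nonunital_algebra "free_alg X :: ('k, _) nalg"
    by (rule free_alg_nonunital_algebra)
  show ?thesis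
    unfolding free_alg_ideal_def ideal_of_def subspace_of_def
    using zero_closed add_closed scale_closed mult_closed by auto
qed

sublocale carrier: free_alg_ideal "lpa_gens E"
  "Carrier (free_alg (lpa_gens E)) :: (('v, 'e) lpa_gen list \<Rightarrow>\<^sub>0 'k) set"
  by (rule free_alg_ideal_carrier)

lemma overideal_annihilator:
  assumes P: "overideal P"
  shows "overideal (annihilator P)"
proof -
  interpret P: free_alg_ideal "lpa_gens E" P by (rule overidealD[OF P])
  have "ideal_of (free_alg (lpa_gens E)) (annihilator P)"
  proof (rule ideal_of_free_algI)
    fix x w and c :: 'k assume x: "x \<in> annihilator P" and w: "set w \<subseteq> lpa_gens E"
    let ?s = "Poly_Mapping.single w c"
    \<comment> \<open>The monomial is moved to where it is absorbed: into \<open>y\<close>, which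
      stays in \<open>P\<close>, or outside the product, which stays in
      \<open>lpa_ideal E\<close>.\<close>
    have "?s * (x * y) \<in> lpa_ideal E" "(y * ?s) * x \<in> lpa_ideal E"
      "x * (?s * y) \<in> lpa_ideal E" "(y * x) * ?s \<in> lpa_ideal E" if "y \<in> P" for y
      using x that P.single_left[OF that w, of c] P.single_right[OF that w, of c] w
      by (auto simp: annihilator_def intro: lpa_ideal.single_left lpa_ideal.single_right)
    then show "?s * x \<in> annihilator P" "x * ?s \<in> annihilator P"
      using x w by (auto simp: annihilator_def mult.assoc intro: carrier.single_left carrier.single_right)
  qed (auto simp: annihilator_def distrib_left distrib_right intro: lpa_ideal.zero lpa_ideal.add
        carrier.zero carrier.add)
  moreover have "lpa_ideal E \<subseteq> annihilator P"
    by (auto simp: annihilator_def intro: lpa_ideal.closed lpa_ideal.mult_left lpa_ideal.mult_right P.closed)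
  ultimately show ?thesis by (simp add: overideal_def)
qed

text \<open>The product of the degree \<open>n\<close> part of \<open>a\<close> with the degree
  \<open>m\<close> part of \<open>x\<close> is the degree \<open>n + m\<close> part of an element of
  \<open>lpa_ideal E\<close>, which is a homogeneous ideal. Summing over \<open>m\<close> recovers
  \<open>x\<close>.\<close>

lemma graded_annihilator:
  assumes P: "overideal P" and graded: "\<And>x n. x \<in> P \<Longrightarrow> deg_part n x \<in> P"
    and a: "a \<in> annihilator P"
  shows "deg_part n a \<in> annihilator P"
proof -
  interpret P: free_alg_ideal "lpa_gens E" P by (rule overidealD[OF P])
  have "deg_part n a * x \<in> lpa_ideal E \<and> x * deg_part n a \<in> lpa_ideal E" if x: "x \<in> P" for x
  proof -
    have "deg_part n a * deg_part m x \<in> lpa_ideal E \<and> deg_part m x * deg_part n a \<in> lpa_ideal E" for m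
    proof -
      have "a * deg_part m x \<in> lpa_ideal E" "deg_part m x * a \<in> lpa_ideal E"
        using a graded[OF x] by (auto simp: annihilator_def)
      then have "deg_part (n + m) (a * deg_part m x) \<in> lpa_ideal E"
        "deg_part (n + m) (deg_part m x * a) \<in> lpa_ideal E"
        by (auto intro: deg_part_lpa_ideal)
      then show ?thesis by (simp add: deg_part_mult_homogeneous[of m] deg_part_deg_part)
    qed
    then have "(\<Sum>m \<in> word_deg ` Poly_Mapping.keys x. deg_part n a * deg_part m x) \<in> lpa_ideal E"
      "(\<Sum>m \<in> word_deg ` Poly_Mapping.keys x. deg_part m x * deg_part n a) \<in> lpa_ideal E"
      by (auto intro: lpa_ideal.sum)
    then show ?thesis
      by (simp only: sum_distrib_left[symmetric] sum_distrib_right[symmetric] sum_deg_part[of x, symmetric])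
  qed
  then show ?thesis using a by (simp add: annihilator_def deg_part_in_free_alg)
qed

lemma vertex_in_annihilator_iff:
  assumes P: "overideal P" and graded: "\<And>x n. x \<in> P \<Longrightarrow> deg_part n x \<in> P" and v: "v \<in> verts E"
  shows "word_elem [Vertex v] \<in> annihilator P \<longleftrightarrow>
    (\<forall>p h. awalk v p h \<longrightarrow> word_elem [Vertex h] \<notin> P)"
proof (intro iffI allI impI notI)
  fix p h assume "word_elem [Vertex v] \<in> annihilator P" and p: "awalk v p h"
    and h: "word_elem [Vertex h] \<in> P"
  then have "word_elem [Vertex h] \<in> annihilator P"
    using overideal_hereditary[OF overideal_annihilator[OF P]] by blast
  then have "word_elem [Vertex h, Vertex h] \<in> (lpa_ideal E :: (_ \<Rightarrow>\<^sub>0 'k) set)"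
    using h by (auto simp: annihilator_def single_append)
  then have "word_elem [Vertex h] \<doteq> 0"
    using cong_trans[OF cong_sym[OF cong_relators(1)]] awalk_last_in_verts[OF p]
    by (simp add: cong_0_iff[symmetric])
  then show False using vertex_not_in_lpa_ideal by (simp add: cong_0_iff)
next
  assume no_path: "\<forall>p h. awalk v p h \<longrightarrow> word_elem [Vertex h] \<notin> P"
  \<comment> \<open>The arbitrary word \<open>w\<close> makes \<open>K\<close> a two-sided ideal,
    which \<open>v x = x v = 0\<close> alone does not in general. The inclusion of \<open>P\<close>
    in \<open>K\<close> can then be checked on vertices.\<close>
  define K :: "(('v, 'e) lpa_gen list \<Rightarrow>\<^sub>0 'k) set" where "K = {x \<in> Carrier (free_alg (lpa_gens E)). \<forall>w. set w \<subseteq> lpa_gens E \<longrightarrow>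
    word_elem (Vertex v # w) * x \<in> lpa_ideal E \<and> x * word_elem (w @ [Vertex v]) \<in> lpa_ideal E}"
  have "ideal_of (free_alg (lpa_gens E)) K"
  proof (rule ideal_of_free_algI)
    fix x u and c :: 'k assume x: "x \<in> K" and u: "set u \<subseteq> lpa_gens E"
    let ?s = "Poly_Mapping.single u c"
    have "word_elem (Vertex v # w) * (?s * x) \<in> lpa_ideal E" "(?s * x) * word_elem (w @ [Vertex v]) \<in> lpa_ideal E"
      "word_elem (Vertex v # w) * (x * ?s) \<in> lpa_ideal E" "(x * ?s) * word_elem (w @ [Vertex v]) \<in> lpa_ideal E"
      if "set w \<subseteq> lpa_gens E" for w
    proof -
      \<comment> \<open>The word \<open>u\<close> of the monomial is absorbed into the arbitrary
        word \<open>w\<close>.\<close>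
      have "word_elem (Vertex v # w @ u) * x \<in> lpa_ideal E" "x * word_elem ((u @ w) @ [Vertex v]) \<in> lpa_ideal E"
        using x u that by (simp_all add: K_def del: append_assoc)
      then have "Poly_Mapping.single [] c * (word_elem (Vertex v # w @ u) * x) \<in> lpa_ideal E"
        "(x * word_elem ((u @ w) @ [Vertex v])) * Poly_Mapping.single [] c \<in> lpa_ideal E"
        using lpa_ideal.single_left[of _ "[]" c] lpa_ideal.single_right[of _ "[]" c] by simp_all
      then show "word_elem (Vertex v # w) * (?s * x) \<in> lpa_ideal E" "(x * ?s) * word_elem (w @ [Vertex v]) \<in> lpa_ideal E"
        by (simp_all add: mult.assoc single_append) (simp_all add: mult.assoc[symmetric] single_append)
      have "(word_elem (Vertex v # w) * x) * ?s \<in> lpa_ideal E" "?s * (x * word_elem (w @ [Vertex v])) \<in> lpa_ideal E"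
        using x u that by (auto simp: K_def intro: lpa_ideal.single_left lpa_ideal.single_right)
      then show "word_elem (Vertex v # w) * (x * ?s) \<in> lpa_ideal E" "(?s * x) * word_elem (w @ [Vertex v]) \<in> lpa_ideal E"
        by (simp_all only: mult.assoc)
    qed
    then show "?s * x \<in> K" "x * ?s \<in> K"
      using x u unfolding K_def by (auto intro: carrier.single_left carrier.single_right)
  qed (auto simp: K_def distrib_left distrib_right intro: lpa_ideal.zero lpa_ideal.add
        carrier.zero carrier.add)
  moreover have "lpa_ideal E \<subseteq> K"
    using v by (auto simp: K_def intro!: lpa_ideal.single_left lpa_ideal.single_right intro: lpa_ideal.closed)
  ultimately have K: "overideal K" by (simp add: overideal_def)
  have "P \<subseteq> K"
  proof (rule graded_overideal_subset[OF P K _ graded])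
    fix h assume h: "h \<in> verts E" "word_elem [Vertex h] \<in> P"
    \<comment> \<open>A common vertex of the two trees would lie in \<open>P\<close>, being reached
      from \<open>h\<close>, and would also be reached from \<open>v\<close>.\<close>
    have disj: False if "awalk v p x" "awalk h q x" for p q x
      using overideal_hereditary[OF P that(2) h(2)] no_path that(1) by blast
    have "word_elem (Vertex v # w @ [Vertex h]) \<doteq> 0" "word_elem (Vertex h # w @ [Vertex v]) \<doteq> 0"
      if "set w \<subseteq> lpa_gens E" for w
      by (rule disjoint_trees_word[OF _ v h(1) that] disjoint_trees_word[OF _ h(1) v that], erule (1) disj)+
    then show "word_elem [Vertex h] \<in> K"
      using h(1) unfolding K_def by (simp add: single_append cong_0_iff carrier_free_alg)
  qed
  \<comment> \<open>The empty word \<open>w\<close> gives the two products with \<open>v\<close>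
    itself.\<close>
  then show "word_elem [Vertex v] \<in> annihilator P"
    using v unfolding annihilator_def K_def by (fastforce simp: carrier_free_alg dest: spec[of _ "[]"])
qed

section \<open>Ideals of the Leavitt path algebra\<close>


abbreviation lpa_class :: "(('v, 'e) lpa_gen list \<Rightarrow>\<^sub>0 'k) \<Rightarrow> ('v, 'e, 'k) lpa_elem" where
  "lpa_class \<equiv> coset_of (free_alg (lpa_gens E)) (lpa_ideal E)"

abbreviation lpaE :: "('k, ('v, 'e, 'k) lpa_elem) nalg" where
  "lpaE \<equiv> lpa E"

lemma lpa_class_eq_iff: "lpa_class p = lpa_class q \<longleftrightarrow> p \<doteq> q"
proof
  assume eq: "lpa_class p = lpa_class q"
  have "p \<in> lpa_class p" unfolding coset_of_def using lpa_ideal.zero by force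
  then obtain i where "i \<in> lpa_ideal E" "p = q + i"
    unfolding eq by (auto simp: coset_of_def)
  then show "p \<doteq> q" by (simp add: lpa_cong_def)
next
  have "lpa_class p \<subseteq> lpa_class q" if "p \<doteq> q" for p q
  proof
    fix x assume "x \<in> lpa_class p"
    then obtain i where i: "i \<in> lpa_ideal E" "x = p + i" by (auto simp: coset_of_def)
    then have "x = q + ((p - q) + i)" "(p - q) + i \<in> lpa_ideal E"
      using that lpa_ideal.add by (auto simp: lpa_cong_def)
    then show "x \<in> lpa_class q" by (simp only: coset_of_def free_alg_simps) blast
  qed
  then show "p \<doteq> q \<Longrightarrow> lpa_class p = lpa_class q" using cong_sym by blast
qed

lemma lpa_vertex_eq: "lpa_vertex E v = lpa_class (word_elem [Vertex v])"
  by (simp add: lpa_word_def)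

lemma lpa_Carrier: "Carrier lpaE = lpa_class ` Carrier (free_alg (lpa_gens E))"
  and lpa_Zero: "Zero lpaE = lpa_class 0"
  by (simp_all add: lpa_def quotient_alg_def)

lemma lpa_ops:
  assumes p: "p \<in> Carrier (free_alg (lpa_gens E))"
  shows "Scale lpaE c (lpa_class p) = lpa_class (Poly_Mapping.single [] c * p)"
    and "q \<in> Carrier (free_alg (lpa_gens E)) \<Longrightarrow> Add lpaE (lpa_class p) (lpa_class q) = lpa_class (p + q)"
    and "q \<in> Carrier (free_alg (lpa_gens E)) \<Longrightarrow> Mult lpaE (lpa_class p) (lpa_class q) = lpa_class (p * q)"
proof -
  interpret nonunital_algebra "free_alg (lpa_gens E) :: ('k, _) nalg"
    by (rule free_alg_nonunital_algebra)
  note ops = quotient_ops[OF lpa_ideal.ideal p]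
  show "Scale lpaE c (lpa_class p) = lpa_class (Poly_Mapping.single [] c * p)"
    using ops(3)[OF p] by (simp add: lpa_def)
  show "Add lpaE (lpa_class p) (lpa_class q) = lpa_class (p + q)"
    "Mult lpaE (lpa_class p) (lpa_class q) = lpa_class (p * q)"
    if "q \<in> Carrier (free_alg (lpa_gens E))"
    using ops(1,2)[OF that] by (simp_all add: lpa_def)
qed

text \<open>Preimage under the quotient map. Together with images under \<open>lpa_class\<close> it
  gives the bijection between the ideals of \<open>lpaE\<close> and the overideals.\<close>

definition lift :: "('v, 'e, 'k) lpa_elem set \<Rightarrow> (('v, 'e) lpa_gen list \<Rightarrow>\<^sub>0 'k) set" where
  "lift T = {p \<in> Carrier (free_alg (lpa_gens E)). lpa_class p \<in> T}"

lemma image_lift: "T \<subseteq> Carrier lpaE \<Longrightarrow> lpa_class ` lift T = T"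
  unfolding lift_def lpa_Carrier by blast

lemma lift_image: "overideal P \<Longrightarrow> lift (lpa_class ` P) = P"
proof -
  assume P: "overideal P"
  interpret P: free_alg_ideal "lpa_gens E" P by (rule overidealD[OF P])
  show ?thesis
    unfolding lift_def using P.closed overidealD(3)[OF P] by (auto simp: lpa_class_eq_iff)
qed

lemma overideal_lift:
  assumes T: "ideal_of lpaE T"
  shows "overideal (lift T)"
proof -
  have sub: "Zero lpaE \<in> T" "\<And>x y. x \<in> T \<Longrightarrow> y \<in> T \<Longrightarrow> Add lpaE x y \<in> T"
    "\<And>c x. x \<in> T \<Longrightarrow> Scale lpaE c x \<in> T"
    "\<And>a x. a \<in> Carrier lpaE \<Longrightarrow> x \<in> T \<Longrightarrow> Mult lpaE a x \<in> T"
    "\<And>a x. a \<in> Carrier lpaE \<Longrightarrow> x \<in> T \<Longrightarrow> Mult lpaE x a \<in> T"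
    using T unfolding ideal_of_def subspace_of_def by auto
  have "lpa_class p \<in> T" if "p \<in> lpa_ideal E" for p
    using sub(1) that lpa_class_eq_iff[of p 0] by (simp add: lpa_Zero cong_0_iff)
  then have "lpa_ideal E \<subseteq> lift T"
    using lpa_ideal.closed by (auto simp: lift_def)
  moreover have "lpa_class (p + q) \<in> T" if "p \<in> lift T" "q \<in> lift T" for p q
    using that sub(2)[of "lpa_class p" "lpa_class q"] by (simp add: lift_def lpa_ops)
  moreover have "lpa_class (Poly_Mapping.single [] c * p) \<in> T" if "p \<in> lift T" for c p
    using that sub(3)[of "lpa_class p" c] by (simp add: lift_def lpa_ops)
  moreover have "lpa_class (a * p) \<in> T" "lpa_class (p * a) \<in> T"
    if "p \<in> lift T" "a \<in> Carrier (free_alg (lpa_gens E))" for a p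
    using that sub(4,5)[of "lpa_class a" "lpa_class p"] by (simp_all add: lift_def lpa_ops lpa_Carrier)
  moreover have "0 \<in> lift T" using sub(1) by (simp add: lift_def lpa_Zero carrier.zero)
  ultimately show ?thesis
    unfolding overideal_def ideal_of_def subspace_of_def
    by (auto simp: lift_def intro: carrier.add carrier.scale carrier.mult_left)
qed

lemma ideal_image:
  assumes P: "overideal P"
  shows "ideal_of lpaE (lpa_class ` P)"
proof -
  interpret P: free_alg_ideal "lpa_gens E" P by (rule overidealD[OF P])
  show ?thesis
    unfolding ideal_of_def subspace_of_def lpa_Carrier lpa_Zero
    using P.closed P.zero
    by (auto simp: lpa_ops intro: imageI P.add P.scale P.mult_left P.mult_right)
qed

lemma perp_eq:
  assumes T: "ideal_of lpaE T"
  shows "perp lpaE T = lpa_class ` annihilator (lift T)"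
proof -
  have T_eq: "T = lpa_class ` lift T"
    using T image_lift[of T] unfolding ideal_of_def subspace_of_def by simp
  have "(\<forall>x\<in>T. Mult lpaE (lpa_class a) x = Zero lpaE \<and> Mult lpaE x (lpa_class a) = Zero lpaE) \<longleftrightarrow>
      (\<forall>x\<in>lift T. a * x \<in> lpa_ideal E \<and> x * a \<in> lpa_ideal E)"
    if "a \<in> Carrier (free_alg (lpa_gens E))" for a
  proof -
    have "Mult lpaE (lpa_class a) (lpa_class x) = Zero lpaE \<longleftrightarrow> a * x \<in> lpa_ideal E"
      "Mult lpaE (lpa_class x) (lpa_class a) = Zero lpaE \<longleftrightarrow> x * a \<in> lpa_ideal E"
      if "x \<in> lift T" for x
      using that \<open>a \<in> _\<close> by (simp_all add: lift_def lpa_ops lpa_Zero lpa_class_eq_iff cong_0_iff)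
    then show ?thesis by (subst T_eq) simp
  qed
  then show ?thesis unfolding perp_def annihilator_def lpa_Carrier by auto
qed

section \<open>Vertices and homogeneous components in the quotient\<close>

lemma lpa_H_eq: "lpa_H E T = {v \<in> verts E. word_elem [Vertex v] \<in> lift T}"
  by (auto simp: lpa_H_def lift_def lpa_vertex_eq carrier_free_alg)

text \<open>The spanning products are classes of words of degree \<open>n\<close>, and the classes
  with a representative homogeneous of degree \<open>n\<close> form a subspace.\<close>

lemma lpa_comp_homogeneous:
  assumes "x \<in> (lpa_comp E n :: ('v, 'e, 'k) lpa_elem set)"
  obtains p where "p \<in> Carrier (free_alg (lpa_gens E))" "deg_part n p = p" "x = lpa_class p"
proof -
  let ?S = "lpa_class ` {p \<in> Carrier (free_alg (lpa_gens E)). deg_part n p = p}"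
  have "subspace_of lpaE ?S"
    unfolding subspace_of_def lpa_Carrier lpa_Zero
    by (auto simp: lpa_ops deg_part_single_mult carrier.zero carrier.add carrier.scale intro!: imageI)
  moreover have "Mult lpaE (lpa_path E u p) (lpa_path_star E u' q) \<in> ?S"
    if p: "awalk u p v" and q: "awalk u' q v'" and n: "int (length p) - int (length q) = n" for u p v u' q v'
  proof -
    \<comment> \<open>A trivial path is written as the one-letter word of its vertex, so that the
      word is nonempty and lies in the nonunital free algebra.\<close>
    define a where "a = (if p = [] then [Vertex u] else map Edge p)"
    define b where "b = (if q = [] then [Vertex u'] else map Ghost (rev q))"
    have u: "u \<in> verts E" "u' \<in> verts E" "set p \<subseteq> arcs E" "set q \<subseteq> arcs E"
      using p q by (auto simp: awalk_def)
    then have ab: "a \<noteq> []" "set a \<subseteq> lpa_gens E" "b \<noteq> []" "set b \<subseteq> lpa_gens E"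
      by (auto simp: a_def b_def)
    have "lpa_path E u p = lpa_class (word_elem a)" "lpa_path_star E u' q = lpa_class (word_elem b)"
      by (simp_all add: lpa_path_def lpa_path_star_def lpa_word_def a_def b_def)
    then have "Mult lpaE (lpa_path E u p) (lpa_path_star E u' q) = lpa_class (word_elem (a @ b))"
      using ab by (simp add: lpa_ops single_in_free_alg single_append)
    moreover have "word_deg (a @ b) = n"
      using n by (auto simp: a_def b_def)
    ultimately show ?thesis
      using ab by (auto simp: deg_part_single carrier_free_alg intro!: imageI)
  qed
  ultimately have "lpa_comp E n \<subseteq> ?S"
    unfolding lpa_comp_def span_of_def by (intro Inter_lower) blast
  then show thesis using assms that by blast
qed

text \<open>The classes of those elements of \<open>lift J\<close> whose components all lie in
  \<open>lift J\<close> form a subspace. It contains the homogeneous elements of \<open>J\<close>,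
  which span \<open>J\<close>.\<close>

lemma graded_lift:
  assumes J: "graded_ideal E J" and p: "p \<in> lift J"
  shows "deg_part n p \<in> lift J"
proof -
  have ideal: "ideal_of lpaE J" and span: "J = span_of lpaE (\<Union>n. J \<inter> lpa_comp E n)"
    using J by (simp_all add: graded_ideal_def direct_sum_of_def)
  note lift = overideal_lift[OF ideal]
  interpret L: free_alg_ideal "lpa_gens E" "lift J" by (rule overidealD[OF lift])
  let ?S = "lpa_class ` {p \<in> lift J. \<forall>n. deg_part n p \<in> lift J}"
  have "subspace_of lpaE ?S"
    unfolding subspace_of_def lpa_Carrier lpa_Zero
    using L.closed
    by (auto simp: lpa_ops deg_part_single_mult L.zero intro!: imageI L.add L.scale)
  moreover have "x \<in> ?S" if "x \<in> J" "x \<in> lpa_comp E m" for x m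
  proof -
    obtain q where q: "q \<in> Carrier (free_alg (lpa_gens E))" "deg_part m q = q" "x = lpa_class q"
      using lpa_comp_homogeneous[OF \<open>x \<in> lpa_comp E m\<close>] .
    then have "q \<in> lift J" using \<open>x \<in> J\<close> by (simp add: lift_def)
    moreover have "deg_part k q \<in> lift J" for k
      using deg_part_deg_part[of k m q] q(2) \<open>q \<in> lift J\<close> L.zero by (cases "k = m") simp_all
    ultimately show ?thesis using q(3) by blast
  qed
  ultimately have "span_of lpaE (\<Union>n. J \<inter> lpa_comp E n) \<subseteq> ?S"
    unfolding span_of_def by (intro Inter_lower) blast
  then have "lpa_class p \<in> ?S" using span p by (auto simp: lift_def)
  then obtain q where q: "lpa_class p = lpa_class q" "deg_part n q \<in> lift J" by blast
  \<comment> \<open>\<open>p\<close> and the chosen \<open>q\<close> differ by an element of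
    \<open>lpa_ideal E\<close>, whose components lie there too.\<close>
  then have "deg_part n p \<doteq> deg_part n q"
    using deg_part_lpa_ideal[of "p - q" n] by (simp add: lpa_class_eq_iff lpa_cong_def)
  then show ?thesis using overidealD(3)[OF lift _ q(2)] by blast
qed

text \<open>Gradedness in terms of representatives. Annihilators inherit this form, which allows the
  passage to \<open>perp\<close> to be iterated.\<close>

definition lift_graded :: "('v, 'e, 'k) lpa_elem set \<Rightarrow> bool" where
  "lift_graded T \<longleftrightarrow> ideal_of lpaE T \<and> (\<forall>p\<in>lift T. \<forall>n. deg_part n p \<in> lift T)"

lemma perp_graded:
  assumes "lift_graded T"
  shows "lift_graded (perp lpaE T)" "lpa_H E (perp lpaE T) = verts E - lpa_Hbar E T"
proof -
  have T: "ideal_of lpaE T" and graded: "\<And>p n. p \<in> lift T \<Longrightarrow> deg_part n p \<in> lift T"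
    using assms by (auto simp: lift_graded_def)
  note T' = overideal_lift[OF T]
  have lift: "lift (perp lpaE T) = annihilator (lift T)"
    using lift_image[OF overideal_annihilator[OF T']] by (simp add: perp_eq[OF T])
  show "lift_graded (perp lpaE T)"
    unfolding lift_graded_def lift
    using ideal_image[OF overideal_annihilator[OF T']] graded_annihilator[OF T' graded]
    by (simp add: perp_eq[OF T])
  show "lpa_H E (perp lpaE T) = verts E - lpa_Hbar E T"
    using vertex_in_annihilator_iff[OF T' graded]
    by (auto simp: lpa_H_eq lift lpa_Hbar_def dest: awalk_last_in_verts)
qed

text \<open>The inclusion from left to right is proved on preimages: \<open>T\<close> is graded, and
  its vertices lie in the ideal that they generate.\<close>

lemma graded_eq_lpa_I:
  assumes "lift_graded T"
  shows "T = lpa_I E (lpa_H E T)"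
proof
  have T: "ideal_of lpaE T" and graded: "\<And>p n. p \<in> lift T \<Longrightarrow> deg_part n p \<in> lift T"
    using assms by (auto simp: lift_graded_def)
  then have TC: "T \<subseteq> Carrier lpaE" by (simp add: ideal_of_def subspace_of_def)
  have vT: "lpa_vertex E ` lpa_H E T \<subseteq> T" by (auto simp: lpa_H_def)
  then show "lpa_I E (lpa_H E T) \<subseteq> T"
    unfolding lpa_I_def gen_ideal_def using T by (intro Inter_lower) simp
  interpret nonunital_algebra "lpaE" by (rule lpa_nonunital_algebra[OF wf_digraph_axioms])
  have I: "ideal_of lpaE (lpa_I E (lpa_H E T))"
    unfolding lpa_I_def using vT TC by (intro ideal_of_gen_ideal) blast
  have "lift T \<subseteq> lift (lpa_I E (lpa_H E T))"
  proof (rule graded_overideal_subset[OF overideal_lift[OF T] overideal_lift[OF I] _ graded])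
    fix v assume v: "v \<in> verts E" "word_elem [Vertex v] \<in> lift T"
    then have "lpa_class (word_elem [Vertex v]) \<in> lpa_I E (lpa_H E T)"
      unfolding lpa_I_def gen_ideal_def by (auto simp: lpa_H_eq lpa_vertex_eq)
    then show "word_elem [Vertex v] \<in> lift (lpa_I E (lpa_H E T))"
      using v by (simp add: lift_def)
  qed
  then show "T \<subseteq> lpa_I E (lpa_H E T)"
    by (subst image_lift[OF TC, symmetric]) (auto simp: lift_def)
qed

end

section \<open>The annihilator, the double annihilator and regularity\<close>

theorem proposition3p7:
  fixes E :: "('v, 'e) pre_digraph"
    and J :: "('v, 'e, 'k::field) lpa_elem set"
  assumes "wf_digraph E"
    and "countable (verts E)"
    and "countable (arcs E)"
    and "row_finite E"
    and "graded_ideal E J"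
  shows "perp (lpa E) J = lpa_I E (verts E - lpa_Hbar E J) \<and>
    perp (lpa E) (perp (lpa E) J) = lpa_I E {w \<in> verts E. lpa_tree E w \<subseteq> lpa_Hbar E J} \<and>
    (regular_ideal (lpa E) J \<longleftrightarrow> lpa_H E J = {w \<in> verts E. lpa_tree E w \<subseteq> lpa_Hbar E J})"
proof -
  interpret row_finite_lpa E "TYPE('k)"
    using assms by (simp add: row_finite_lpa_def row_finite_lpa_axioms_def)
  let ?W = "{w \<in> verts E. lpa_tree E w \<subseteq> lpa_Hbar E J}"
  have J: "lift_graded J" "ideal_of lpaE J"
    using assms(5) graded_lift by (auto simp: lift_graded_def graded_ideal_def)
  note P = perp_graded[OF J(1)]
  note PP = perp_graded[OF P(1)]
  \<comment> \<open>A vertex lies outside \<open>lpa_Hbar E (perp lpaE J)\<close> exactly if its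
    tree misses the vertices of the annihilator, which are those outside
    \<open>lpa_Hbar E J\<close>.\<close>
  have "verts E - lpa_Hbar E (perp lpaE J) = ?W"
    using P(2) awalk_last_in_verts by (auto simp: lpa_Hbar_def[of _ "perp lpaE J"] lpa_tree_def)
  then have W: "lpa_H E (perp lpaE (perp lpaE J)) = ?W"
    using PP(2) by simp
  have 1: "perp lpaE J = lpa_I E (verts E - lpa_Hbar E J)"
    using graded_eq_lpa_I[OF P(1)] P(2) by simp
  have 2: "perp lpaE (perp lpaE J) = lpa_I E ?W"
    using graded_eq_lpa_I[OF PP(1)] W by simp
  have 3: "regular_ideal lpaE J \<longleftrightarrow> lpa_H E J = ?W"
  proof
    assume "regular_ideal lpaE J"
    then show "lpa_H E J = ?W" using W by (simp add: regular_ideal_def)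
  next
    assume "lpa_H E J = ?W"
    \<comment> \<open>Both \<open>J\<close> and its double annihilator are the ideals generated by
      their vertices, and these are now the same.\<close>
    then have "J = perp lpaE (perp lpaE J)" using 2 graded_eq_lpa_I[OF J(1)] by simp
    then show "regular_ideal lpaE J" using J(2) by (simp add: regular_ideal_def)
  qed
  from 1 2 3 show ?thesis by blast
qed

end
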